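(* Let $m,n\in\mathbf N$, $\alpha,\beta>0$, $\sigma>1$, $p\in\mathbf R\setminus\{0,1\}$, $\frac1p+\frac1q=1$. Put $$\Phi(x):=\|x\|_\alpha^{p(m-\sigma)-m}\ (x\in\mathbf R_+^m),\qquad \Psi(y):=\|y\|_\beta^{q(n+\sigma)-n}\ (y\in\mathbf R_+^n),$$ $$K(\sigma):=\left[\frac{\Gamma^n(\frac1\beta)}{\beta^{n-1}\Gamma(\frac n\beta)}\right]^{\frac1p}\left[\frac{\Gamma^m(\frac1\alpha)}{\alpha^{m-1}\Gamma(\frac m\alpha)}\right]^{\frac1q}\frac{\Gamma(\sigma)}{2^{\sigma-1}}\zeta(\sigma).$$ Let $f(x)=f(x_1,\dots,x_m)\ge0$ on $\mathbf R_+^m$ and $g(y)=g(y_1,\dots,y_n)\ge0$ on $\mathbf R_+^n$ be measurable with $$0<\|f\|_{p,\Phi}:=\left\{\int_{\mathbf R_+^m}\Phi(x)f^p(x)\,dx\right\}^{\frac1p}<\infty,\qquad 0<\|g\|_{q,\Psi}:=\left\{\int_{\mathbf R_+^n}\Psi(y)g^q(y)\,dy\right\}^{\frac1q}<\infty.$$ (i) If $p>1$, then the following two inequalities hold and are equivalent: $$\int_{\mathbf R_+^n}\int_{\mathbf R_+^m}\left(\coth\frac{\|x\|_\alpha}{\|y\|_\beta}-1\right)f(x)g(y)\,dx\,dy<K(\sigma)\|f\|_{p,\Phi}\|g\|_{q,\Psi},\qquad (A)$$ $$\left\{\int_{\mathbf R_+^n}\|y\|_\beta^{-p\sigma-n}\left(\int_{\mathbf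 R_+^m}\left(\coth\frac{\|x\|_\alpha}{\|y\|_\beta}-1\right)f(x)\,dx\right)^pdy\right\}^{\frac1p}<K(\sigma)\|f\|_{p,\Phi},\qquad (B)$$ and the constant factor $K(\sigma)$ is the best possible in each of (A) and (B). (ii) If $0<p<1$ or $p<0$, then the reverses of (A) and (B) (i.e. with $<$ replaced by $>$) hold and are equivalent, with the same constant factor $K(\sigma)$, which is the best possible in each of them.
   Context: $\mathbf N$ is the set of positive integers, $\mathbf R_+=(0,\infty)$. For $x\in\mathbf R^m$, $\|x\|_\alpha:=\left(\sum_{k=1}^m|x_k|^\alpha\right)^{1/\alpha}$; for $y\in\mathbf R^n$, $\|y\|_\beta:=\left(\sum_{k=1}^n|y_k|^\beta\right)^{1/\beta}$. $\coth u=\frac{e^u+e^{-u}}{e^u-e^{-u}}$; $\Gamma$ is the Gamma function and $\zeta(\sigma)=\sum_{k\ge1}k^{-\sigma}$ the Riemann zeta function. "Best possible" means that, for the given parameters, the inequality for all admissible functions fails if $K(\sigma)$ is replaced by a smaller constant (in the reverse inequalities: by a larger constant). "Equivalent" means that the first inequality (for all admissible $f,g$) and the second (for all admissible $f$) imply one another. Integrals of nonnegative functions take values in $[0,\infty]$; for negative exponents $r$, $0^r=+\infty$ and $(+\infty)^r=0$. The symbols $\|\cdot\|_{p,\Phi}$, $\|\cdot\|_{q,\Psi}$ are used formally also when the exponent is less than $1$. *)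

theory Defs
  imports "HOL-Analysis.Analysis"
begin

definition pos_orthant :: "(real ^ 'd) set" where
  "pos_orthant = {x. \<forall>k. 0 < x $ k}"

abbreviation orthant_measure :: "(real ^ 'd) measure" where
  "orthant_measure \<equiv> lebesgue_on pos_orthant"

definition norm_exp :: "real \<Rightarrow> real ^ 'd \<Rightarrow> real" where
  "norm_exp a x = (\<Sum>k\<in>UNIV. \<bar>x $ k\<bar> powr a) powr (1 / a)"

definition coth :: "real \<Rightarrow> real" where
  "coth u = (exp u + exp (- u)) / (exp u - exp (- u))"

definition zeta_real :: "real \<Rightarrow> real" where
  "zeta_real s = (\<Sum>k. real (Suc k) powr (- s))"

(* Real powers on [0, \<infinity>]; for a negative exponent, 0 is sent to \<infinity> and \<infinity> to 0
   (whereas 0 powr r = 0 on the reals). *)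
definition epowr :: "ennreal \<Rightarrow> real \<Rightarrow> ennreal"  (infixr \<open>epowr\<close> 80) where
  "a epowr r =
    (if r = 0 then 1
     else if a = 0 then (if r < 0 then \<infinity> else 0)
     else if a = \<infinity> then (if r < 0 then 0 else \<infinity>)
     else ennreal (enn2real a powr r))"

definition Phi :: "real \<Rightarrow> real \<Rightarrow> real \<Rightarrow> real ^ 'm \<Rightarrow> real" where
  "Phi \<alpha> \<sigma> p x = norm_exp \<alpha> x powr (p * (real CARD('m) - \<sigma>) - real CARD('m))"

definition Psi :: "real \<Rightarrow> real \<Rightarrow> real \<Rightarrow> real ^ 'n \<Rightarrow> real" where
  "Psi \<beta> \<sigma> q y = norm_exp \<beta> y powr (q * (real CARD('n) + \<sigma>) - real CARD('n))"

definition best_const :: "nat \<Rightarrow> nat \<Rightarrow> real \<Rightarrow> real \<Rightarrow> real \<Rightarrow> real \<Rightarrow> real \<Rightarrow> real" where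
  "best_const m n \<alpha> \<beta> p q \<sigma> =
     (Gamma (1 / \<beta>) ^ n / (\<beta> ^ (n - 1) * Gamma (real n / \<beta>))) powr (1 / p) *
     (Gamma (1 / \<alpha>) ^ m / (\<alpha> ^ (m - 1) * Gamma (real m / \<alpha>))) powr (1 / q) *
     (Gamma \<sigma> / 2 powr (\<sigma> - 1)) * zeta_real \<sigma>"

definition weighted_norm :: "real \<Rightarrow> (real ^ 'd \<Rightarrow> real) \<Rightarrow> (real ^ 'd \<Rightarrow> real) \<Rightarrow> ennreal" where
  "weighted_norm r w h =
     (\<integral>\<^sup>+ x. ennreal (w x) * (ennreal (h x) epowr r) \<partial>orthant_measure) epowr (1 / r)"

definition admissible :: "real \<Rightarrow> (real ^ 'd \<Rightarrow> real) \<Rightarrow> (real ^ 'd \<Rightarrow> real) set" where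
  "admissible r w =
     {h. h \<in> borel_measurable orthant_measure \<and> (\<forall>x\<in>pos_orthant. 0 \<le> h x) \<and>
         0 < weighted_norm r w h \<and> weighted_norm r w h < \<infinity>}"

definition kernel :: "real \<Rightarrow> real \<Rightarrow> real ^ 'm \<Rightarrow> real ^ 'n \<Rightarrow> real" where
  "kernel \<alpha> \<beta> x y = coth (norm_exp \<alpha> x / norm_exp \<beta> y) - 1"

definition lhs_A :: "real \<Rightarrow> real \<Rightarrow> (real ^ 'm \<Rightarrow> real) \<Rightarrow> (real ^ 'n \<Rightarrow> real) \<Rightarrow> ennreal" where
  "lhs_A \<alpha> \<beta> f g =
     (\<integral>\<^sup>+ y. (\<integral>\<^sup>+ x. ennreal (kernel \<alpha> \<beta> x y * f x * g y) \<partial>orthant_measure) \<partial>orthant_measure)"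

(* The type argument fixes the dimension of the outer variable y. *)
definition lhs_B ::
  "'n::finite itself \<Rightarrow> real \<Rightarrow> real \<Rightarrow> real \<Rightarrow> real \<Rightarrow> (real ^ 'm \<Rightarrow> real) \<Rightarrow> ennreal" where
  "lhs_B _ \<alpha> \<beta> p \<sigma> f =
     (\<integral>\<^sup>+ (y :: real ^ 'n). ennreal (norm_exp \<beta> y powr (- p * \<sigma> - real CARD('n))) *
        ((\<integral>\<^sup>+ x. ennreal (kernel \<alpha> \<beta> x y * f x) \<partial>orthant_measure) epowr p)
      \<partial>orthant_measure) epowr (1 / p)"

(* The two inequalities for all admissible functions, with constant C.  The relation R is (<)
   for the direct inequalities and (>) for the reverse ones. *)
definition ineq_A ::
  "'m::finite itself \<Rightarrow> 'n::finite itself \<Rightarrow> (ennreal \<Rightarrow> ennreal \<Rightarrow> bool) \<Rightarrow>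
   real \<Rightarrow> real \<Rightarrow> real \<Rightarrow> real \<Rightarrow> real \<Rightarrow> real \<Rightarrow> bool" where
  "ineq_A _ _ R \<alpha> \<beta> p q \<sigma> C \<longleftrightarrow>
     (\<forall>f \<in> admissible p (Phi \<alpha> \<sigma> p :: real ^ 'm \<Rightarrow> real).
      \<forall>g \<in> admissible q (Psi \<beta> \<sigma> q :: real ^ 'n \<Rightarrow> real).
        R (lhs_A \<alpha> \<beta> f g)
          (ennreal C * weighted_norm p (Phi \<alpha> \<sigma> p) f * weighted_norm q (Psi \<beta> \<sigma> q) g))"

definition ineq_B ::
  "'m::finite itself \<Rightarrow> 'n::finite itself \<Rightarrow> (ennreal \<Rightarrow> ennreal \<Rightarrow> bool) \<Rightarrow>
   real \<Rightarrow> real \<Rightarrow> real \<Rightarrow> real \<Rightarrow> real \<Rightarrow> bool" where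
  "ineq_B _ _ R \<alpha> \<beta> p \<sigma> C \<longleftrightarrow>
     (\<forall>f \<in> admissible p (Phi \<alpha> \<sigma> p :: real ^ 'm \<Rightarrow> real).
        R (lhs_B TYPE('n) \<alpha> \<beta> p \<sigma> f) (ennreal C * weighted_norm p (Phi \<alpha> \<sigma> p) f))"

end

theory Submission
  imports Defs
begin

text \<open>Write \<open>\<parallel>x\<parallel>\<close> and \<open>\<parallel>y\<parallel>\<close> for the two norms and put \<open>F x = \<parallel>x\<parallel> powr (m - \<sigma>) * f x\<close>, \<open>G y = \<parallel>y\<parallel> powr (n + \<sigma>) * g y\<close>.
With respect to the dilation-invariant measures \<open>\<mu> = dx / \<parallel>x\<parallel>^m\<close> and \<open>\<nu> = dy / \<parallel>y\<parallel>^n\<close> the weighted norms of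
\<open>f\<close> and \<open>g\<close> become the plain norms of \<open>F\<close> and \<open>G\<close>, and in the coordinates \<open>a = - ln \<parallel>x\<parallel>\<close>,
\<open>b = - ln \<parallel>y\<parallel>\<close> the kernel becomes a convolution kernel \<open>\<phi> (a - b)\<close>. Polar coordinates
(\<open>emeasure_norm_exp_less\<close>, \<open>distr_log_measure\<close>) say that \<open>a\<close> and \<open>b\<close> map \<open>\<mu>\<close> and \<open>\<nu>\<close> to constant multiples
\<open>S\<^sub>a\<close> and \<open>S\<^sub>b\<close> of Lebesgue measure, and a series expansion gives the mass \<open>k\<close> of \<open>\<phi>\<close> as
\<open>\<Gamma>(\<sigma>) \<zeta>(\<sigma>) / 2 powr (\<sigma> - 1)\<close> (\<open>nn_integral_coth_log_kernel\<close>).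

For fixed \<open>y\<close> the kernel has mass \<open>S\<^sub>a k\<close> in \<open>x\<close>, so Jensen's inequality compares the \<open>p\<close>-th power of the inner
integral of \<open>F\<close> with that of \<open>F powr p\<close>; integrating over \<open>y\<close> and using the other marginal \<open>S\<^sub>b k\<close> gives the
second inequality for \<open>p > 1\<close> and its reverse for \<open>p < 1\<close> (\<open>norm_T_less\<close>, \<open>norm_T_greater\<close>). Equality would force
\<open>F\<close> to be constant almost everywhere, which is excluded because \<open>\<mu>\<close> is infinite. The first inequality follows
from the second, with any constant, by the direct or the reverse Hoelder inequality (\<open>form_le_norms\<close>,
\<open>form_ge_norms\<close>).

The constant is optimal because of the test functions \<open>F = exp (- e \<bar>a\<bar> / p)\<close>, \<open>G = exp (- e \<bar>b\<bar> / q)\<close>: as \<open>e\<close> tends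
to 0, the quotient of the bilinear form by the product of the norms tends to the constant, whatever the signs
of \<open>p\<close> and \<open>q\<close> (\<open>best_le_if_form_le\<close>, \<open>best_ge_if_form_ge\<close>).\<close>

section \<open>Real powers of extended nonnegative reals\<close>

lemma ennreal_pos_cases [case_names zero infinity pos]:
  fixes a :: ennreal
  obtains "a = 0" | "a = \<infinity>" | t where "a = ennreal t" "0 < t"
  by (metis ennreal_0 ennreal_cases infinity_ennreal_def not_gr_zero ennreal_less_zero_iff)

lemma epowr_ennreal: "0 < t \<Longrightarrow> ennreal t epowr r = ennreal (t powr r)"
  by (auto simp: epowr_def)

lemma epowr_0_left: "0 epowr r = (if r = 0 then 1 else if r < 0 then \<infinity> else 0)"
  by (simp add: epowr_def)

lemma epowr_top_left: "top epowr r = (if r = 0 then 1 else if r < 0 then 0 else (top::ennreal))"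
  by (simp add: epowr_def)

lemma epowr_1_right [simp]: "a epowr 1 = a"
  by (cases a rule: ennreal_pos_cases) (auto simp: epowr_def)

lemma borel_measurable_epowr [measurable (raw)]:
  assumes [measurable]: "f \<in> borel_measurable M"
  shows "(\<lambda>x. f x epowr r) \<in> borel_measurable M"
  unfolding epowr_def by measurable

lemma epowr_epowr: "(a epowr r) epowr s = a epowr (r * s)"
  by (cases a rule: ennreal_pos_cases)
     (auto simp: epowr_ennreal powr_powr epowr_0_left epowr_top_left mult_less_0_iff mult_le_0_iff not_less
           zero_less_mult_iff epowr_def)

lemma epowr_eq_0_iff: "a epowr r = 0 \<longleftrightarrow> (a = 0 \<and> 0 < r) \<or> (a = \<infinity> \<and> r < 0)"
  by (cases a rule: ennreal_pos_cases) (auto simp: epowr_ennreal epowr_0_left epowr_top_left)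

lemma epowr_eq_top_iff: "a epowr r = \<infinity> \<longleftrightarrow> (a = \<infinity> \<and> 0 < r) \<or> (a = 0 \<and> r < 0)"
  by (cases a rule: ennreal_pos_cases) (auto simp: epowr_ennreal epowr_0_left epowr_top_left)

text \<open>One factor is a positive real: for a negative exponent the rule fails at \<open>0 \<cdot> \<infinity>\<close>.\<close>

lemma epowr_mult_ennreal:
  assumes "0 < t"
  shows "(ennreal t * a) epowr r = ennreal (t powr r) * a epowr r"
proof (cases a rule: ennreal_pos_cases)
  case (pos u)
  then show ?thesis
    using assms by (simp add: epowr_ennreal powr_mult flip: ennreal_mult)
qed (use assms in \<open>auto simp: epowr_0_left epowr_top_left ennreal_mult_top\<close>)

lemma epowr_mult_pos:
  assumes "0 < r"
  shows "(a * b) epowr r = a epowr r * b epowr r"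
proof (cases a rule: ennreal_pos_cases)
  case infinity
  then show ?thesis
    using assms by (cases "b = 0") (auto simp: epowr_0_left epowr_top_left ennreal_top_mult epowr_eq_0_iff)
qed (use assms in \<open>auto simp: epowr_0_left epowr_mult_ennreal epowr_ennreal\<close>)

lemma epowr_strict_mono:
  assumes "a < b" "0 < r"
  shows "a epowr r < b epowr r"
proof (cases a rule: ennreal_pos_cases)
  case zero
  then show ?thesis
    using assms by (simp add: epowr_0_left zero_less_iff_neq_zero epowr_eq_0_iff)
next
  case infinity
  then show ?thesis
    using assms by simp
next
  case (pos t)
  show ?thesis
    using assms pos
    by (cases b rule: ennreal_pos_cases)
       (auto simp: epowr_top_left epowr_ennreal ennreal_less_iff intro!: powr_less_mono2)
qed

lemma epowr_strict_antimono:
  assumes "a < b" "r < 0"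
  shows "b epowr r < a epowr r"
proof (cases a rule: ennreal_pos_cases)
  case zero
  then show ?thesis
    using assms epowr_eq_top_iff[of b r] by (auto simp: epowr_0_left less_top)
next
  case infinity
  then show ?thesis
    using assms by simp
next
  case (pos t)
  show ?thesis
    using assms pos
    by (cases b rule: ennreal_pos_cases)
       (auto simp: epowr_top_left epowr_ennreal ennreal_less_iff intro!: powr_less_mono2_neg)
qed

lemma epowr_mono: "a \<le> b \<Longrightarrow> 0 < r \<Longrightarrow> a epowr r \<le> b epowr r"
  using epowr_strict_mono[of a b r] by (cases "a = b") (auto intro: less_imp_le)

lemma epowr_add:
  assumes "0 < a" "a < \<infinity>"
  shows "a epowr (r + s) = a epowr r * a epowr s"
  using assms by (cases a rule: ennreal_pos_cases) (auto simp: epowr_ennreal powr_add ennreal_mult)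

lemma epowr_mult_epowr_minus:
  assumes "0 < a" "a < \<infinity>"
  shows "a epowr r * a epowr (- r) = 1"
  using epowr_add[OF assms, of r "- r"] by (simp add: epowr_def)

section \<open>Hoelder inequalities in the extended nonnegative reals\<close>

lemma Youngs_inequality_ennreal:
  assumes "1 < p" "1 < q" "1 / p + 1 / q = 1"
  shows "a * b \<le> ennreal (1 / p) * a epowr p + ennreal (1 / q) * b epowr q"
proof -
  have *: ?thesis if "a = 0 \<or> b = 0 \<or> a = \<infinity> \<or> b = \<infinity>"
    using that assms by (auto simp: epowr_top_left ennreal_mult_top)
  show ?thesis
  proof (cases a rule: ennreal_pos_cases; cases b rule: ennreal_pos_cases)
    fix s t :: real
    assume st: "a = ennreal s" "0 < s" "b = ennreal t" "0 < t"
    have "s * t \<le> s powr p / p + t powr q / q"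
      using Youngs_inequality[of p q s t] assms st by auto
    then show ?thesis
      using st assms by (simp add: epowr_ennreal ennreal_leI flip: ennreal_mult ennreal_plus)
  qed (use * in auto)
qed

lemma Hoelder_inequality_ennreal:
  assumes [measurable]: "U \<in> borel_measurable M" "G \<in> borel_measurable M"
    and pq: "1 < p" "1 < q" "1 / p + 1 / q = 1"
  shows "(\<integral>\<^sup>+x. U x * G x \<partial>M) \<le>
    (\<integral>\<^sup>+x. U x epowr p \<partial>M) epowr (1 / p) * (\<integral>\<^sup>+x. G x epowr q \<partial>M) epowr (1 / q)"
    (is "?L \<le> ?P epowr _ * ?Q epowr _")
proof -
  consider "?P = 0" | "?Q = 0" | "?P \<noteq> 0" "?Q \<noteq> 0" "?P = \<infinity> \<or> ?Q = \<infinity>"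
    | A B where "?P = ennreal A" "?Q = ennreal B" "0 < A" "0 < B"
    by (cases ?P rule: ennreal_pos_cases; cases ?Q rule: ennreal_pos_cases) auto
  then show ?thesis
  proof cases
    case 1
    then have "AE x in M. U x = 0"
      using pq by (subst (asm) nn_integral_0_iff_AE) (auto simp: epowr_eq_0_iff)
    then have "?L = 0"
      by (subst nn_integral_0_iff_AE) auto
    then show ?thesis by simp
  next
    case 2
    then have "AE x in M. G x = 0"
      using pq by (subst (asm) nn_integral_0_iff_AE) (auto simp: epowr_eq_0_iff)
    then have "?L = 0"
      by (subst nn_integral_0_iff_AE) auto
    then show ?thesis by simp
  next
    case 3
    then have "?P epowr (1 / p) * ?Q epowr (1 / q) = \<infinity>"
      using pq by (auto simp: epowr_top_left ennreal_top_mult ennreal_mult_top epowr_eq_0_iff)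
    then show ?thesis by simp
  next
    case 4
    \<comment> \<open>Normalising by the norms makes Young's inequality integrate to the constant 1.\<close>
    define c d where "c = A powr (1 / p)" and "d = B powr (1 / q)"
    have pos: "0 < c" "0 < d" using 4 by (auto simp: c_def d_def)
    have cp: "inverse c powr p = 1 / A" and dq: "inverse d powr q = 1 / B"
      using 4 pq by (auto simp: c_def d_def powr_powr inverse_eq_divide powr_divide)
    have *: "U x * G x \<le> ennreal (c * d) *
       (ennreal (1 / p) * (ennreal (1 / A) * U x epowr p) + ennreal (1 / q) * (ennreal (1 / B) * G x epowr q))" for x
    proof -
      have "U x * G x = ennreal (c * d) * ((ennreal (inverse c) * U x) * (ennreal (inverse d) * G x))"
      proof -
        have "ennreal (c * d) * (ennreal (inverse c) * ennreal (inverse d)) = 1"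
          using pos by (simp add: field_simps flip: ennreal_mult ennreal_1)
        then show ?thesis
          by (metis (no_types, lifting) mult.assoc mult.left_commute mult_1)
      qed
      also have "\<dots> \<le> ennreal (c * d) * (ennreal (1 / p) * (ennreal (inverse c) * U x) epowr p +
          ennreal (1 / q) * (ennreal (inverse d) * G x) epowr q)"
        by (intro mult_left_mono Youngs_inequality_ennreal pq) auto
      finally show ?thesis
        using pos by (simp add: epowr_mult_ennreal cp dq)
    qed
    have "?L \<le> (\<integral>\<^sup>+x. ennreal (c * d) *
       (ennreal (1 / p) * (ennreal (1 / A) * U x epowr p) + ennreal (1 / q) * (ennreal (1 / B) * G x epowr q)) \<partial>M)"
      by (intro nn_integral_mono *)
    also have "\<dots> = ennreal (c * d) *
       (ennreal (1 / p) * (ennreal (1 / A) * ?P) + ennreal (1 / q) * (ennreal (1 / B) * ?Q))"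
      by (simp add: nn_integral_cmult nn_integral_add)
    also have "\<dots> = ennreal (c * d)"
      using 4 pq by (simp flip: ennreal_mult ennreal_plus)
    also have "\<dots> = ?P epowr (1 / p) * ?Q epowr (1 / q)"
      using 4 by (simp add: c_def d_def epowr_ennreal ennreal_mult)
    finally show ?thesis .
  qed
qed

text \<open>The reverse inequality with \<open>0 < r < 1\<close> and \<open>s < 0\<close> is the direct one for the exponents \<open>1/r\<close> and
\<open>1/(1-r)\<close>, applied to \<open>W powr r = (W V) powr r * V powr (- r)\<close>. No positivity or finiteness is assumed: where the factors degenerate,
the conventions \<open>0 epowr s = \<infinity>\<close> and \<open>\<infinity> epowr s = 0\<close> make the left side vanish, or \<open>W V\<close> has infinite integral.\<close>

lemma reverse_Hoelder_inequality_ennreal: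
  assumes [measurable]: "W \<in> borel_measurable M" "V \<in> borel_measurable M"
    and r: "0 < r" "r < 1" and rs: "1 / r + 1 / s = 1"
  shows "(\<integral>\<^sup>+x. W x epowr r \<partial>M) epowr (1 / r) * (\<integral>\<^sup>+x. V x epowr s \<partial>M) epowr (1 / s)
    \<le> (\<integral>\<^sup>+x. W x * V x \<partial>M)" (is "?P epowr _ * ?Q epowr _ \<le> ?L")
proof -
  have s: "s = - (r / (1 - r))"
  proof -
    have "s \<noteq> 0" using r rs by auto
    then show ?thesis using r rs by (simp add: field_simps)
  qed
  then have s0: "s < 0" using r by simp
  consider "?L = \<infinity>" | "?Q = \<infinity>" | "?L \<noteq> \<infinity>" "?Q = 0" | "?L \<noteq> \<infinity>" "?Q \<noteq> 0" "?Q \<noteq> \<infinity>"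
    by blast
  then show ?thesis
  proof cases
    case 1
    then show ?thesis by simp
  next
    case 2
    then show ?thesis using s0 by (simp add: epowr_top_left)
  next
    case 3
    then have "AE x in M. V x = \<infinity>"
      using s0 by (subst (asm) nn_integral_0_iff_AE) (auto simp: epowr_eq_0_iff)
    moreover have "AE x in M. W x * V x \<noteq> \<infinity>"
      using 3 by (intro nn_integral_noteq_infinite) auto
    ultimately have "AE x in M. W x epowr r = 0"
      by eventually_elim (use r in \<open>auto simp: ennreal_mult_top epowr_eq_0_iff split: if_splits\<close>)
    then have "?P = 0"
      by (subst nn_integral_0_iff_AE) auto
    then show ?thesis
      using r by (simp add: epowr_0_left)
  next
    case 4
    have V: "AE x in M. V x epowr s \<noteq> \<infinity>"
      using 4 by (intro nn_integral_noteq_infinite) auto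
    have WV: "AE x in M. W x * V x \<noteq> \<infinity>"
      using 4 by (intro nn_integral_noteq_infinite) auto
    have "AE x in M. W x epowr r \<le> (W x * V x) epowr r * V x epowr (- r)"
      using V WV
    proof eventually_elim
      case (elim x)
      then have V0: "V x \<noteq> 0" using s0 by (auto simp: epowr_0_left)
      show ?case
      proof (cases "V x = \<infinity>")
        case True
        then have "W x = 0" using elim by (auto simp: ennreal_mult_top split: if_splits)
        then show ?thesis using r by (simp add: epowr_0_left)
      next
        case False
        then have "V x epowr r * V x epowr (- r) = 1"
          using V0 by (intro epowr_mult_epowr_minus) (auto simp: zero_less_iff_neq_zero top.not_eq_extremum)
        then show ?thesis
          using r by (simp add: epowr_mult_pos mult.assoc)
      qed
    qed
    then have "?P \<le> (\<integral>\<^sup>+x. (W x * V x) epowr r * V x epowr (- r) \<partial>M)"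
      by (rule nn_integral_mono_AE)
    also have "\<dots> \<le> (\<integral>\<^sup>+x. ((W x * V x) epowr r) epowr (1 / r) \<partial>M) epowr (1 / (1 / r)) *
        (\<integral>\<^sup>+x. (V x epowr (- r)) epowr (1 / (1 - r)) \<partial>M) epowr (1 / (1 / (1 - r)))"
      using r by (intro Hoelder_inequality_ennreal) (auto simp: field_simps)
    also have "\<dots> = ?L epowr r * ?Q epowr (1 - r)"
      using r s by (simp add: epowr_epowr)
    finally have "?P epowr (1 / r) \<le> (?L epowr r * ?Q epowr (1 - r)) epowr (1 / r)"
      using r by (intro epowr_mono) auto
    also have "\<dots> = ?L * ?Q epowr (- (1 / s))"
      using r s by (simp add: epowr_mult_pos epowr_epowr)
    finally have "?P epowr (1 / r) * ?Q epowr (1 / s) \<le> ?L * ?Q epowr (- (1 / s)) * ?Q epowr (1 / s)"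
      by (rule mult_right_mono) simp
    also have "\<dots> = ?L"
      using 4 epowr_mult_epowr_minus[of ?Q "1 / s"]
      by (simp add: mult.assoc mult.commute[of "_ epowr (- (1 / s))"] zero_less_iff_neq_zero top.not_eq_extremum)
    finally show ?thesis .
  qed
qed

section \<open>Strict Jensen inequalities for powers\<close>

text \<open>For \<open>p > 1\<close> and for \<open>p < 0\<close> the power function is strictly convex, so it lies above its tangents.\<close>

lemma powr_gt_tangent:
  fixes c t p :: real
  assumes p: "1 < p \<or> p < 0" and "0 < c" "0 < t" "t \<noteq> c"
  shows "c powr p + p * c powr (p - 1) * (t - c) < t powr p"
proof -
  have mvt: "\<exists>z. u < z \<and> z < v \<and> v powr p - u powr p = (v - u) * (p * z powr (p - 1))"
    if "0 < u" "u < v" for u v :: real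
    using that by (intro MVT2) (auto intro!: derivative_eq_intros)
  have mono: "p * u powr (p - 1) < p * v powr (p - 1)" if "0 < u" "u < v" for u v :: real
    using p that powr_less_mono2[of "p - 1" u v] powr_less_mono2_neg[of "p - 1" u v]
    by (auto simp: mult_less_cancel_left)
  show ?thesis
  proof (cases "c < t")
    case True
    with mvt[of c t] assms obtain z where z: "c < z" "z < t"
      "t powr p - c powr p = (t - c) * (p * z powr (p - 1))" by auto
    have "(t - c) * (p * c powr (p - 1)) < (t - c) * (p * z powr (p - 1))"
      using z mono[of c z] assms True by simp
    then show ?thesis using z by (simp add: algebra_simps)
  next
    case False
    with mvt[of t c] assms obtain z where z: "t < z" "z < c"
      "c powr p - t powr p = (c - t) * (p * z powr (p - 1))" by auto
    have "(c - t) * (p * z powr (p - 1)) < (c - t) * (p * c powr (p - 1))"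
      using z mono[of z c] assms False by simp
    then show ?thesis using z by (simp add: algebra_simps)
  qed
qed

text \<open>\<open>T\<close> is the total mass. Integrating the tangent inequality at the mean \<open>c\<close> of \<open>F\<close> gives the claim, with equality
only if \<open>F = c\<close> almost everywhere.\<close>

lemma strict_Jensen_powr_convex:
  fixes F :: "'a \<Rightarrow> real"
  assumes T: "emeasure L (space L) = ennreal T" "0 < T"
    and F[measurable]: "F \<in> borel_measurable L" and nonneg: "\<And>x. x \<in> space L \<Longrightarrow> 0 \<le> F x"
    and p: "1 < p \<or> p < 0"
    and fin: "(\<integral>\<^sup>+x. ennreal (F x) epowr p \<partial>L) < \<infinity>"
    and nonconst: "\<And>c. \<not> (AE x in L. F x = c)"
  shows "(\<integral>\<^sup>+x. ennreal (F x) \<partial>L) epowr p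
    < ennreal (T powr (p - 1)) * (\<integral>\<^sup>+x. ennreal (F x) epowr p \<partial>L)" (is "?m epowr p < _ * ?P")
proof -
  interpret L: finite_measure L
    using T by (intro finite_measureI) auto
  have mT: "measure L (space L) = T"
    using T by (simp add: measure_def)
  have AEpow: "AE x in L. ennreal (F x) epowr p = ennreal (F x powr p) \<and> (p < 0 \<longrightarrow> 0 < F x)"
  proof -
    have "AE x in L. ennreal (F x) epowr p \<noteq> \<infinity>"
      using fin by (intro nn_integral_noteq_infinite) auto
    then show ?thesis
      using AE_space
    proof eventually_elim
      case (elim x)
      then show ?case
        using nonneg[of x] p by (cases "F x = 0") (auto simp: epowr_ennreal epowr_0_left split: if_splits)
    qed
  qed
  have P_eq: "?P = (\<integral>\<^sup>+x. ennreal (F x powr p) \<partial>L)"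
    using AEpow by (intro nn_integral_cong_AE) auto
  have intP: "integrable L (\<lambda>x. F x powr p)"
    using fin by (intro integrableI_nonneg) (auto simp: P_eq)
  have m0: "?m \<noteq> 0"
  proof
    assume "?m = 0"
    then have "AE x in L. ennreal (F x) = 0"
      by (subst (asm) nn_integral_0_iff_AE) auto
    then have "AE x in L. F x = 0"
      using AE_space by eventually_elim (use nonneg in \<open>auto simp: ennreal_eq_0_iff intro: antisym\<close>)
    then show False using nonconst by blast
  qed
  have P0: "?P \<noteq> 0" if "p < 0"
  proof
    assume "?P = 0"
    then have "AE x in L. ennreal (F x) epowr p = 0"
      by (subst (asm) nn_integral_0_iff_AE) auto
    then have "AE x in L. False"
      by eventually_elim (use that in \<open>auto simp: epowr_eq_0_iff\<close>)
    then have "AE x in L. F x = 0"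
      by eventually_elim simp
    then show False using nonconst by blast
  qed
  show ?thesis
  proof (cases "?m = \<infinity>")
    case True
    have "p < 0"
    proof (rule ccontr)
      assume "\<not> p < 0"
      with p have "1 < p" by simp
      have "?m \<le> (\<integral>\<^sup>+x. 1 + ennreal (F x) epowr p \<partial>L)"
      proof (intro nn_integral_mono_AE, use AEpow AE_space in eventually_elim)
        case (elim x)
        have "F x \<le> 1 + F x powr p"
        proof (cases "F x \<le> 1")
          case False
          then have "F x powr 1 \<le> F x powr p" using \<open>1 < p\<close> by (intro powr_mono) auto
          then show ?thesis using False by simp
        qed (use powr_ge_zero[of "F x" p] in linarith)
        then have "ennreal (F x) \<le> ennreal (1 + F x powr p)" by (rule ennreal_leI)
        then show ?case using elim by simp
      qed
      also have "\<dots> < \<infinity>"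
        using fin T by (simp add: nn_integral_add ennreal_add_eq_top less_top)
      finally show False using True by simp
    qed
    then show ?thesis
      using P0 T True by (auto simp: epowr_top_left zero_less_iff_neq_zero)
  next
    case False
    have intF: "integrable L F"
      using False AE_space nonneg by (intro integrableI_nonneg) (auto simp: less_top)
    define m where "m = (\<integral>x. F x \<partial>L)"
    have m_eq: "?m = ennreal m"
      unfolding m_def using nonneg by (intro nn_integral_eq_integral intF) auto
    have m_pos: "0 < m"
      using m0 unfolding m_eq by (auto simp: not_less ennreal_neg intro: ccontr)
    define c where "c = m / T"
    have c: "0 < c" using m_pos T by (simp add: c_def)
    \<comment> \<open>The gap between the power and its tangent at the mean.\<close>
    define D where "D x = F x powr p - (c powr p + p * c powr (p - 1) * (F x - c))" for x
    have D: "0 < D x" if "0 \<le> F x" "F x \<noteq> c" "p < 0 \<longrightarrow> 0 < F x" for x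
    proof (cases "F x = 0")
      case True
      with p that have "1 < p" by auto
      have "c powr (p - 1) * c = c powr p" using c by (simp add: powr_diff)
      then have "D x = (p - 1) * c powr p" using True by (simp add: D_def algebra_simps)
      then show ?thesis using \<open>1 < p\<close> c by simp
    next
      case False
      then show ?thesis using powr_gt_tangent[of p c "F x"] that p c by (simp add: D_def)
    qed
    have D_AE: "AE x in L. 0 \<le> D x \<and> (D x = 0 \<longrightarrow> F x = c)"
      using AEpow AE_space
    proof eventually_elim
      case (elim x)
      then show ?case
        using D[of x] nonneg[of x] by (cases "F x = c") (auto simp: D_def less_imp_le)
    qed
    have intD: "integrable L D"
      unfolding D_def by (intro Bochner_Integration.integrable_diff Bochner_Integration.integrable_add
        Bochner_Integration.integrable_mult_right intP intF L.integrable_const)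
    have "(\<integral>x. D x \<partial>L) \<noteq> 0"
    proof
      assume "(\<integral>x. D x \<partial>L) = 0"
      then have "AE x in L. D x = 0"
        using D_AE intD by (subst (asm) integral_nonneg_eq_0_iff_AE) auto
      then have "AE x in L. F x = c"
        using D_AE by eventually_elim auto
      then show False using nonconst by blast
    qed
    moreover have "0 \<le> (\<integral>x. D x \<partial>L)"
      using D_AE by (intro integral_nonneg_AE) auto
    moreover have "(\<integral>x. D x \<partial>L) = (\<integral>x. F x powr p \<partial>L) - (c powr p * T + p * c powr (p - 1) * (m - c * T))"
      unfolding D_def using intP intF by (simp add: mT m_def mult.commute)
    ultimately have "c powr p * T < (\<integral>x. F x powr p \<partial>L)"
      using T by (simp add: c_def)
    then have "m powr p < T powr (p - 1) * (\<integral>x. F x powr p \<partial>L)"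
      using T m_pos by (simp add: c_def powr_divide powr_diff field_simps)
    then have "ennreal (m powr p) < ennreal (T powr (p - 1)) * ennreal (\<integral>x. F x powr p \<partial>L)"
      by (simp add: ennreal_less_iff flip: ennreal_mult')
    then show ?thesis
      using m_pos intP by (simp add: m_eq epowr_ennreal P_eq nn_integral_eq_integral)
  qed
qed

text \<open>The concave case \<open>0 < p < 1\<close> is the convex case for \<open>F powr p\<close> and the exponent \<open>1/p\<close>.\<close>

lemma strict_Jensen_powr_concave:
  fixes F :: "'a \<Rightarrow> real"
  assumes T: "emeasure L (space L) = ennreal T" "0 < T"
    and F[measurable]: "F \<in> borel_measurable L" and nonneg: "\<And>x. x \<in> space L \<Longrightarrow> 0 \<le> F x"
    and p: "0 < p" "p < 1"
    and fin: "(\<integral>\<^sup>+x. ennreal (F x) epowr p \<partial>L) < \<infinity>"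
    and nonconst: "\<And>c. \<not> (AE x in L. F x = c)"
  shows "ennreal (T powr (p - 1)) * (\<integral>\<^sup>+x. ennreal (F x) epowr p \<partial>L)
    < (\<integral>\<^sup>+x. ennreal (F x) \<partial>L) epowr p" (is "_ * ?P < ?m epowr p")
proof (cases "?m = \<infinity>")
  case True
  then show ?thesis
    using fin p by (simp add: epowr_top_left ennreal_mult_less_top)
next
  case False
  have pow: "ennreal (F x powr p) = ennreal (F x) epowr p" if "x \<in> space L" for x
    using nonneg[OF that] p by (cases "F x = 0") (auto simp: epowr_ennreal epowr_0_left)
  have P_eq: "?P = (\<integral>\<^sup>+x. ennreal (F x powr p) \<partial>L)"
    using pow by (intro nn_integral_cong) auto
  have m_eq: "(\<integral>\<^sup>+x. ennreal (F x powr p) epowr (1 / p) \<partial>L) = ?m"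
    using p by (intro nn_integral_cong) (simp add: pow epowr_epowr)
  have nonconst': "\<not> (AE x in L. F x powr p = c)" for c
  proof
    assume "AE x in L. F x powr p = c"
    then have "AE x in L. F x = c powr (1 / p)"
      using AE_space by eventually_elim (use nonneg p in \<open>auto simp: powr_powr\<close>)
    then show False using nonconst by blast
  qed
  have "?P epowr (1 / p) < ennreal (T powr (1 / p - 1)) * ?m"
    using strict_Jensen_powr_convex[of L T "\<lambda>x. F x powr p" "1 / p"] T nonconst' p False
    by (simp add: m_eq P_eq less_top)
  then have "(?P epowr (1 / p)) epowr p < (ennreal (T powr (1 / p - 1)) * ?m) epowr p"
    using p by (intro epowr_strict_mono)
  also have "\<dots> = ennreal (T powr (1 - p)) * ?m epowr p"
    using T p by (simp add: epowr_mult_ennreal powr_powr left_diff_distrib)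
  finally have "ennreal (T powr (p - 1)) * ?P < ennreal (T powr (p - 1)) * (ennreal (T powr (1 - p)) * ?m epowr p)"
    using p T by (intro ennreal_mult_strict_left_mono) (auto simp: epowr_epowr)
  also have "\<dots> = ?m epowr p"
    using T by (simp add: mult.assoc[symmetric] flip: ennreal_mult powr_add)
  finally show ?thesis .
qed

section \<open>A convolution kernel in logarithmic coordinates\<close>

lemma nn_integral_exp_minus_abs_pos:
  assumes "0 < e"
  shows "\<exists>Z>0. (\<integral>\<^sup>+t. ennreal (exp (- (e * \<bar>t\<bar>))) \<partial>lborel) = ennreal Z"
proof -
  have half: "(\<integral>\<^sup>+t. ennreal (exp (- (e * t))) * indicator {0..} t \<partial>lborel) = ennreal (1 / e)"
  proof -
    have "((\<lambda>t. - exp (- (e * t)) / e) \<longlongrightarrow> 0) at_top"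
      using assms by real_asymp
    then show ?thesis
      using assms
      by (subst nn_integral_FTC_atLeast[where F = "\<lambda>t. - exp (- (e * t)) / e" and T = 0])
         (auto intro!: derivative_eq_intros)
  qed
  let ?I = "\<integral>\<^sup>+t. ennreal (exp (- (e * \<bar>t\<bar>))) \<partial>lborel"
  have "?I \<le> (\<integral>\<^sup>+t. ennreal (exp (- (e * t))) * indicator {0..} t
      + ennreal (exp (- (e * - t))) * indicator {0..} (- t) \<partial>lborel)"
    by (intro nn_integral_mono) (auto split: split_indicator)
  also have "\<dots> = ennreal (1 / e) + (\<integral>\<^sup>+t. ennreal (exp (- (e * - t))) * indicator {0..} (- t) \<partial>lborel)"
    by (subst nn_integral_add) (simp_all only: half, measurable)
  also have "(\<integral>\<^sup>+t. ennreal (exp (- (e * - t))) * indicator {0..} (- t) \<partial>lborel) = ennreal (1 / e)"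
    using nn_integral_real_affine[of "\<lambda>t. ennreal (exp (- (e * t))) * indicator {0..} t" "-1" 0] half
    by simp
  finally have fin: "?I < \<infinity>"
    by (rule le_less_trans) simp
  have "?I \<noteq> 0"
    by (subst nn_integral_0_iff_AE) (auto simp: ennreal_eq_0_iff not_le eventually_False ae_filter_eq_bot_iff emeasure_lborel_UNIV)
  with fin show ?thesis
    by (cases ?I rule: ennreal_pos_cases) auto
qed

text \<open>The common form of the problem in logarithmic coordinates. Under \<open>a\<close> the measure \<open>M\<close> becomes \<open>S\<^sub>a\<close> times
Lebesgue measure on the line, likewise \<open>N\<close> under \<open>b\<close>, and the kernel is \<open>\<phi> (a x - b y)\<close> with \<open>\<phi> > 0\<close> of
mass \<open>k\<close>. Translation invariance makes both marginals of the kernel constant: \<open>S\<^sub>a k\<close> and \<open>S\<^sub>b k\<close>.\<close>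

locale log_kernel =
  M: sigma_finite_measure M + N: sigma_finite_measure N
  for M :: "'a measure" and N :: "'b measure" +
  fixes a :: "'a \<Rightarrow> real" and b :: "'b \<Rightarrow> real" and \<phi> :: "real \<Rightarrow> real" and S\<^sub>a S\<^sub>b k :: real
  assumes a_measurable [measurable]: "a \<in> borel_measurable M"
    and b_measurable [measurable]: "b \<in> borel_measurable N"
    and \<phi>_measurable [measurable]: "\<phi> \<in> borel_measurable borel"
    and distr_a: "distr M borel a = density lborel (\<lambda>_. ennreal S\<^sub>a)"
    and distr_b: "distr N borel b = density lborel (\<lambda>_. ennreal S\<^sub>b)"
    and S_pos: "0 < S\<^sub>a" "0 < S\<^sub>b"
    and \<phi>_pos: "\<And>t. 0 < \<phi> t"
    and \<phi>_int: "(\<integral>\<^sup>+t. ennreal (\<phi> t) \<partial>lborel) = ennreal k"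
    and k_pos: "0 < k"
begin

sublocale MN: pair_sigma_finite M N ..

lemma nn_integral_a:
  assumes [measurable]: "\<psi> \<in> borel_measurable borel"
  shows "(\<integral>\<^sup>+x. \<psi> (a x) \<partial>M) = ennreal S\<^sub>a * (\<integral>\<^sup>+t. \<psi> t \<partial>lborel)"
proof -
  have "(\<integral>\<^sup>+x. \<psi> (a x) \<partial>M) = (\<integral>\<^sup>+t. \<psi> t \<partial>distr M borel a)"
    by (simp add: nn_integral_distr)
  then show ?thesis
    by (simp add: distr_a nn_integral_density nn_integral_cmult)
qed

lemma nn_integral_b:
  assumes [measurable]: "\<psi> \<in> borel_measurable borel"
  shows "(\<integral>\<^sup>+y. \<psi> (b y) \<partial>N) = ennreal S\<^sub>b * (\<integral>\<^sup>+t. \<psi> t \<partial>lborel)"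
proof -
  have "(\<integral>\<^sup>+y. \<psi> (b y) \<partial>N) = (\<integral>\<^sup>+t. \<psi> t \<partial>distr N borel b)"
    by (simp add: nn_integral_distr)
  then show ?thesis
    by (simp add: distr_b nn_integral_density nn_integral_cmult)
qed

lemma mass_a: "(\<integral>\<^sup>+x. ennreal (\<phi> (a x - t)) \<partial>M) = ennreal (S\<^sub>a * k)"
proof -
  have "(\<integral>\<^sup>+x. ennreal (\<phi> (a x - t)) \<partial>M) = ennreal S\<^sub>a * (\<integral>\<^sup>+s. ennreal (\<phi> (s - t)) \<partial>lborel)"
    by (rule nn_integral_a) measurable
  also have "(\<integral>\<^sup>+s. ennreal (\<phi> (s - t)) \<partial>lborel) = ennreal k"
    using nn_integral_real_affine[of "\<lambda>s. ennreal (\<phi> s)" 1 "- t"] \<phi>_int by simp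
  finally show ?thesis
    using S_pos k_pos by (simp add: ennreal_mult)
qed

lemma mass_b: "(\<integral>\<^sup>+y. ennreal (\<phi> (s - b y)) \<partial>N) = ennreal (S\<^sub>b * k)"
proof -
  have "(\<integral>\<^sup>+y. ennreal (\<phi> (s - b y)) \<partial>N) = ennreal S\<^sub>b * (\<integral>\<^sup>+t. ennreal (\<phi> (s - t)) \<partial>lborel)"
    by (rule nn_integral_b) measurable
  also have "(\<integral>\<^sup>+t. ennreal (\<phi> (s - t)) \<partial>lborel) = ennreal k"
    using nn_integral_real_affine[of "\<lambda>s. ennreal (\<phi> s)" "-1" s] \<phi>_int by simp
  finally show ?thesis
    using S_pos k_pos by (simp add: ennreal_mult)
qed

lemma emeasure_M_space: "emeasure M (space M) = \<infinity>"
  using nn_integral_a[of "\<lambda>_. 1"] S_pos by (simp add: ennreal_mult_top emeasure_lborel_UNIV)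

lemma emeasure_N_space: "emeasure N (space N) = \<infinity>"
  using nn_integral_b[of "\<lambda>_. 1"] S_pos by (simp add: ennreal_mult_top emeasure_lborel_UNIV)

text \<open>The integral operator with kernel \<open>\<phi> (a x - b y)\<close>.\<close>

definition T :: "('a \<Rightarrow> real) \<Rightarrow> 'b \<Rightarrow> ennreal" where
  "T F y = (\<integral>\<^sup>+x. ennreal (\<phi> (a x - b y)) * ennreal (F x) \<partial>M)"

lemma T_measurable [measurable]:
  assumes [measurable]: "F \<in> borel_measurable M"
  shows "T F \<in> borel_measurable N"
  unfolding T_def by measurable

lemma iterated_integral:
  assumes [measurable]: "h \<in> borel_measurable M"
  shows "(\<integral>\<^sup>+y. \<integral>\<^sup>+x. ennreal (\<phi> (a x - b y)) * h x \<partial>M \<partial>N) = ennreal (S\<^sub>b * k) * (\<integral>\<^sup>+x. h x \<partial>M)"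
proof -
  have "(\<integral>\<^sup>+y. \<integral>\<^sup>+x. ennreal (\<phi> (a x - b y)) * h x \<partial>M \<partial>N)
      = (\<integral>\<^sup>+x. \<integral>\<^sup>+y. ennreal (\<phi> (a x - b y)) * h x \<partial>N \<partial>M)"
    by (rule MN.Fubini') measurable
  also have "\<dots> = (\<integral>\<^sup>+x. ennreal (S\<^sub>b * k) * h x \<partial>M)"
    by (simp add: nn_integral_multc mass_b)
  also have "\<dots> = ennreal (S\<^sub>b * k) * (\<integral>\<^sup>+x. h x \<partial>M)"
    by (rule nn_integral_cmult) measurable
  finally show ?thesis .
qed

text \<open>The finite measure on \<open>M\<close> given by the kernel for a fixed \<open>y\<close>; its mass does not depend on \<open>y\<close>.\<close>

definition L :: "'b \<Rightarrow> 'a measure" where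
  "L y = density M (\<lambda>x. ennreal (\<phi> (a x - b y)))"

lemma space_L [simp]: "space (L y) = space M"
  and sets_L [measurable_cong]: "sets (L y) = sets M"
  by (simp_all add: L_def)

lemma emeasure_L_space: "emeasure (L y) (space (L y)) = ennreal (S\<^sub>a * k)"
  by (simp add: L_def emeasure_density mass_a cong: nn_integral_cong)

lemma nn_integral_L:
  assumes [measurable]: "h \<in> borel_measurable M"
  shows "(\<integral>\<^sup>+x. h x \<partial>L y) = (\<integral>\<^sup>+x. ennreal (\<phi> (a x - b y)) * h x \<partial>M)"
  unfolding L_def by (rule nn_integral_density) measurable

text \<open>A constant has \<open>p\<close>-th power integral 0 or \<open>\<infinity>\<close>, because \<open>M\<close> has infinite mass. This is what makes the
inequalities strict.\<close>

lemma not_AE_const: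
  assumes [measurable]: "F \<in> borel_measurable M"
    and nonneg: "\<And>x. x \<in> space M \<Longrightarrow> 0 \<le> F x"
    and I: "0 < (\<integral>\<^sup>+x. ennreal (F x) epowr p \<partial>M)" "(\<integral>\<^sup>+x. ennreal (F x) epowr p \<partial>M) < \<infinity>"
  shows "\<not> (AE x in L y. F x = c)"
proof
  assume "AE x in L y. F x = c"
  then have "AE x in M. F x = c"
    using \<phi>_pos AE_density[of "\<lambda>x. ennreal (\<phi> (a x - b y))" M "\<lambda>x. F x = c"]
    unfolding L_def by simp
  then have "(\<integral>\<^sup>+x. ennreal (F x) epowr p \<partial>M) = (\<integral>\<^sup>+x. ennreal c epowr p \<partial>M)"
    by (intro nn_integral_cong_AE) auto
  also have "\<dots> = ennreal c epowr p * \<infinity>"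
    by (simp add: emeasure_M_space)
  finally show False
    using I by (simp add: ennreal_mult_top split: if_splits)
qed

text \<open>Jensen's inequality for each \<open>y\<close>, integrated over \<open>y\<close> with Tonelli's theorem. The other
marginal \<open>S\<^sub>b k\<close> enters through the exchange of the integrals.\<close>

lemma nn_integral_epowr_T_less:
  assumes [measurable]: "F \<in> borel_measurable M"
    and nonneg: "\<And>x. x \<in> space M \<Longrightarrow> 0 \<le> F x"
    and p: "1 < p \<or> p < 0"
    and I: "0 < (\<integral>\<^sup>+x. ennreal (F x) epowr p \<partial>M)" "(\<integral>\<^sup>+x. ennreal (F x) epowr p \<partial>M) < \<infinity>"
  shows "(\<integral>\<^sup>+y. T F y epowr p \<partial>N)
    < ennreal ((S\<^sub>a * k) powr (p - 1) * (S\<^sub>b * k)) * (\<integral>\<^sup>+x. ennreal (F x) epowr p \<partial>M)"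
proof -
  define R where "R y = (\<integral>\<^sup>+x. ennreal (\<phi> (a x - b y)) * ennreal (F x) epowr p \<partial>M)" for y
  have [measurable]: "R \<in> borel_measurable N"
    unfolding R_def by measurable
  have Sk: "0 < S\<^sub>a * k" "0 < S\<^sub>b * k" using S_pos k_pos by auto
  have int_R: "(\<integral>\<^sup>+y. R y \<partial>N) = ennreal (S\<^sub>b * k) * (\<integral>\<^sup>+x. ennreal (F x) epowr p \<partial>M)"
    unfolding R_def by (rule iterated_integral) measurable
  then have "(\<integral>\<^sup>+y. R y \<partial>N) \<noteq> \<infinity>"
    using I by (simp add: ennreal_mult_eq_top_iff less_top)
  then have "AE y in N. R y \<noteq> \<infinity>"
    by (intro nn_integral_noteq_infinite) auto
  then have less: "AE y in N. T F y epowr p < ennreal ((S\<^sub>a * k) powr (p - 1)) * R y"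
  proof eventually_elim
    case (elim y)
    have "(\<integral>\<^sup>+x. ennreal (F x) \<partial>L y) epowr p
        < ennreal ((S\<^sub>a * k) powr (p - 1)) * (\<integral>\<^sup>+x. ennreal (F x) epowr p \<partial>L y)"
      using elim nonneg p Sk not_AE_const[OF _ nonneg I]
      by (intro strict_Jensen_powr_convex emeasure_L_space) (auto simp: nn_integral_L R_def less_top)
    then show ?case
      by (simp add: nn_integral_L R_def T_def)
  qed
  have int_cR: "(\<integral>\<^sup>+y. ennreal ((S\<^sub>a * k) powr (p - 1)) * R y \<partial>N)
      = ennreal ((S\<^sub>a * k) powr (p - 1) * (S\<^sub>b * k)) * (\<integral>\<^sup>+x. ennreal (F x) epowr p \<partial>M)"
    using Sk by (simp add: nn_integral_cmult int_R ennreal_mult mult.assoc)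
  have fin: "(\<integral>\<^sup>+y. ennreal ((S\<^sub>a * k) powr (p - 1)) * R y \<partial>N) < \<infinity>"
    unfolding int_cR using I by (simp add: ennreal_mult_less_top)
  have "(\<integral>\<^sup>+y. T F y epowr p \<partial>N) < (\<integral>\<^sup>+y. ennreal ((S\<^sub>a * k) powr (p - 1)) * R y \<partial>N)"
  proof (rule nn_integral_less)
    have "(\<integral>\<^sup>+y. T F y epowr p \<partial>N) \<le> (\<integral>\<^sup>+y. ennreal ((S\<^sub>a * k) powr (p - 1)) * R y \<partial>N)"
      using less by (intro nn_integral_mono_AE) (auto elim: eventually_mono)
    with fin show "(\<integral>\<^sup>+y. T F y epowr p \<partial>N) \<noteq> \<infinity>" by auto
    show "AE y in N. T F y epowr p \<le> ennreal ((S\<^sub>a * k) powr (p - 1)) * R y"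
      using less by eventually_elim auto
    show "\<not> (AE y in N. ennreal ((S\<^sub>a * k) powr (p - 1)) * R y \<le> T F y epowr p)"
    proof
      assume "AE y in N. ennreal ((S\<^sub>a * k) powr (p - 1)) * R y \<le> T F y epowr p"
      with less have "AE y in N. False" by eventually_elim auto
      then show False using emeasure_N_space by (simp add: eventually_False ae_filter_eq_bot_iff)
    qed
  qed measurable
  then show ?thesis unfolding int_cR .
qed

lemma nn_integral_epowr_T_greater:
  assumes [measurable]: "F \<in> borel_measurable M"
    and nonneg: "\<And>x. x \<in> space M \<Longrightarrow> 0 \<le> F x"
    and p: "0 < p" "p < 1"
    and I: "0 < (\<integral>\<^sup>+x. ennreal (F x) epowr p \<partial>M)" "(\<integral>\<^sup>+x. ennreal (F x) epowr p \<partial>M) < \<infinity>"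
  shows "ennreal ((S\<^sub>a * k) powr (p - 1) * (S\<^sub>b * k)) * (\<integral>\<^sup>+x. ennreal (F x) epowr p \<partial>M)
    < (\<integral>\<^sup>+y. T F y epowr p \<partial>N)"
proof -
  define R where "R y = (\<integral>\<^sup>+x. ennreal (\<phi> (a x - b y)) * ennreal (F x) epowr p \<partial>M)" for y
  have [measurable]: "R \<in> borel_measurable N"
    unfolding R_def by measurable
  have Sk: "0 < S\<^sub>a * k" "0 < S\<^sub>b * k" using S_pos k_pos by auto
  have int_R: "(\<integral>\<^sup>+y. R y \<partial>N) = ennreal (S\<^sub>b * k) * (\<integral>\<^sup>+x. ennreal (F x) epowr p \<partial>M)"
    unfolding R_def by (rule iterated_integral) measurable
  then have "(\<integral>\<^sup>+y. R y \<partial>N) \<noteq> \<infinity>"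
    using I by (simp add: ennreal_mult_eq_top_iff less_top)
  then have "AE y in N. R y \<noteq> \<infinity>"
    by (intro nn_integral_noteq_infinite) auto
  then have less: "AE y in N. ennreal ((S\<^sub>a * k) powr (p - 1)) * R y < T F y epowr p"
  proof eventually_elim
    case (elim y)
    have "ennreal ((S\<^sub>a * k) powr (p - 1)) * (\<integral>\<^sup>+x. ennreal (F x) epowr p \<partial>L y)
        < (\<integral>\<^sup>+x. ennreal (F x) \<partial>L y) epowr p"
      using elim nonneg p Sk not_AE_const[OF _ nonneg I]
      by (intro strict_Jensen_powr_concave emeasure_L_space) (auto simp: nn_integral_L R_def less_top)
    then show ?case
      by (simp add: nn_integral_L R_def T_def)
  qed
  have int_cR: "(\<integral>\<^sup>+y. ennreal ((S\<^sub>a * k) powr (p - 1)) * R y \<partial>N)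
      = ennreal ((S\<^sub>a * k) powr (p - 1) * (S\<^sub>b * k)) * (\<integral>\<^sup>+x. ennreal (F x) epowr p \<partial>M)"
    using Sk by (simp add: nn_integral_cmult int_R ennreal_mult mult.assoc)
  have fin: "(\<integral>\<^sup>+y. ennreal ((S\<^sub>a * k) powr (p - 1)) * R y \<partial>N) < \<infinity>"
    unfolding int_cR using I by (simp add: ennreal_mult_less_top)
  have "(\<integral>\<^sup>+y. ennreal ((S\<^sub>a * k) powr (p - 1)) * R y \<partial>N) < (\<integral>\<^sup>+y. T F y epowr p \<partial>N)"
  proof (rule nn_integral_less)
    show "(\<integral>\<^sup>+y. ennreal ((S\<^sub>a * k) powr (p - 1)) * R y \<partial>N) \<noteq> \<infinity>"
      using fin by simp
    show "AE y in N. ennreal ((S\<^sub>a * k) powr (p - 1)) * R y \<le> T F y epowr p"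
      using less by eventually_elim auto
    show "\<not> (AE y in N. T F y epowr p \<le> ennreal ((S\<^sub>a * k) powr (p - 1)) * R y)"
    proof
      assume "AE y in N. T F y epowr p \<le> ennreal ((S\<^sub>a * k) powr (p - 1)) * R y"
      with less have "AE y in N. False" by eventually_elim auto
      then show False using emeasure_N_space by (simp add: eventually_False ae_filter_eq_bot_iff)
    qed
  qed measurable
  then show ?thesis unfolding int_cR .
qed

section \<open>Norm inequalities and the bilinear form\<close>

text \<open>The best constant in logarithmic coordinates.\<close>

definition best :: "real \<Rightarrow> real \<Rightarrow> real" where
  "best p q = S\<^sub>b powr (1 / p) * S\<^sub>a powr (1 / q) * k"

lemma best_pos: "0 < best p q"
  using S_pos k_pos by (simp add: best_def)

lemma Jensen_const_powr:
  assumes "p \<noteq> 0" "1 / p + 1 / q = 1"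
  shows "((S\<^sub>a * k) powr (p - 1) * (S\<^sub>b * k)) powr (1 / p) = best p q"
proof -
  have q: "1 / q = (p - 1) / p"
    using assms by (simp add: field_simps)
  have "((S\<^sub>a * k) powr (p - 1) * (S\<^sub>b * k)) powr (1 / p)
      = S\<^sub>a powr (1 / q) * S\<^sub>b powr (1 / p) * (k powr (1 / q) * k powr (1 / p))"
    using S_pos k_pos by (simp add: powr_mult powr_powr q)
  also have "k powr (1 / q) * k powr (1 / p) = k"
    using k_pos assms(2) by (simp add: add.commute flip: powr_add)
  finally show ?thesis
    by (simp add: best_def)
qed

lemma norm_T_less:
  assumes F: "F \<in> borel_measurable M" "\<And>x. x \<in> space M \<Longrightarrow> 0 \<le> F x"
    and p: "1 < p" "1 / p + 1 / q = 1"
    and I: "0 < (\<integral>\<^sup>+x. ennreal (F x) epowr p \<partial>M)" "(\<integral>\<^sup>+x. ennreal (F x) epowr p \<partial>M) < \<infinity>"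
  shows "(\<integral>\<^sup>+y. T F y epowr p \<partial>N) epowr (1 / p)
    < ennreal (best p q) * (\<integral>\<^sup>+x. ennreal (F x) epowr p \<partial>M) epowr (1 / p)"
proof -
  have "(\<integral>\<^sup>+y. T F y epowr p \<partial>N) epowr (1 / p)
    < (ennreal ((S\<^sub>a * k) powr (p - 1) * (S\<^sub>b * k)) * (\<integral>\<^sup>+x. ennreal (F x) epowr p \<partial>M)) epowr (1 / p)"
    using p F I by (intro epowr_strict_mono nn_integral_epowr_T_less) auto
  then show ?thesis
    using Jensen_const_powr[of p q] p S_pos k_pos by (simp add: epowr_mult_ennreal)
qed

lemma norm_T_greater:
  assumes F: "F \<in> borel_measurable M" "\<And>x. x \<in> space M \<Longrightarrow> 0 \<le> F x"
    and p: "p < 1" "p \<noteq> 0" "1 / p + 1 / q = 1"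
    and I: "0 < (\<integral>\<^sup>+x. ennreal (F x) epowr p \<partial>M)" "(\<integral>\<^sup>+x. ennreal (F x) epowr p \<partial>M) < \<infinity>"
  shows "ennreal (best p q) * (\<integral>\<^sup>+x. ennreal (F x) epowr p \<partial>M) epowr (1 / p)
    < (\<integral>\<^sup>+y. T F y epowr p \<partial>N) epowr (1 / p)"
proof -
  have "(ennreal ((S\<^sub>a * k) powr (p - 1) * (S\<^sub>b * k)) * (\<integral>\<^sup>+x. ennreal (F x) epowr p \<partial>M)) epowr (1 / p)
    < (\<integral>\<^sup>+y. T F y epowr p \<partial>N) epowr (1 / p)"
  proof (cases "p < 0")
    case True
    then show ?thesis
      using F I by (intro epowr_strict_antimono nn_integral_epowr_T_less) auto
  next
    case False
    then show ?thesis
      using p F I by (intro epowr_strict_mono nn_integral_epowr_T_greater) auto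
  qed
  then show ?thesis
    using Jensen_const_powr[of p q] p S_pos k_pos by (simp add: epowr_mult_ennreal)
qed

lemma form_le_norms:
  assumes [measurable]: "F \<in> borel_measurable M" "G \<in> borel_measurable N"
    and p: "1 < p" "1 / p + 1 / q = 1"
  shows "(\<integral>\<^sup>+y. T F y * ennreal (G y) \<partial>N)
    \<le> (\<integral>\<^sup>+y. T F y epowr p \<partial>N) epowr (1 / p) * (\<integral>\<^sup>+y. ennreal (G y) epowr q \<partial>N) epowr (1 / q)"
proof -
  have "1 < q"
  proof -
    have "q = p / (p - 1)" using p by (cases "q = 0") (auto simp: field_simps)
    then show ?thesis using p by simp
  qed
  then show ?thesis
    using p by (intro Hoelder_inequality_ennreal) auto
qed

lemma form_ge_norms:
  assumes [measurable]: "F \<in> borel_measurable M" "G \<in> borel_measurable N"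
    and p: "p < 1" "p \<noteq> 0" "1 / p + 1 / q = 1"
  shows "(\<integral>\<^sup>+y. T F y epowr p \<partial>N) epowr (1 / p) * (\<integral>\<^sup>+y. ennreal (G y) epowr q \<partial>N) epowr (1 / q)
    \<le> (\<integral>\<^sup>+y. T F y * ennreal (G y) \<partial>N)"
proof (cases "p < 0")
  case True
  have q: "q = p / (p - 1)" using p by (cases "q = 0") (auto simp: field_simps)
  then have "0 < q" "q < 1"
    using True by (simp_all add: divide_neg_neg neg_divide_less_eq)
  then have "(\<integral>\<^sup>+y. ennreal (G y) epowr q \<partial>N) epowr (1 / q) * (\<integral>\<^sup>+y. T F y epowr p \<partial>N) epowr (1 / p)
    \<le> (\<integral>\<^sup>+y. ennreal (G y) * T F y \<partial>N)"
    using p by (intro reverse_Hoelder_inequality_ennreal) auto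
  then show ?thesis
    by (simp add: mult.commute)
next
  case False
  then show ?thesis
    using p by (intro reverse_Hoelder_inequality_ennreal) auto
qed

section \<open>Optimality of the constant\<close>

text \<open>The mass of the kernel function weighted by \<open>exp (d \<bar>t\<bar>)\<close>; if it is finite for some
\<open>d > 0\<close>, it is close to \<open>k\<close> for all small \<open>d\<close>; for \<open>d \<le> 0\<close> it is always finite. It bounds the bilinear form on the test functions.\<close>

definition tilted :: "real \<Rightarrow> ennreal" where
  "tilted d = (\<integral>\<^sup>+t. ennreal (\<phi> t * exp (d * \<bar>t\<bar>)) \<partial>lborel)"

text \<open>Dominated convergence; \<open>c\<close> is an upper bound for the weights.\<close>

lemma tilted_tendsto:
  assumes d: "d \<longlonglongrightarrow> 0" "\<And>n. d n \<le> c" and fin: "tilted c < \<infinity>"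
  shows "(\<lambda>n. tilted (d n)) \<longlonglongrightarrow> ennreal k"
proof -
  have "(\<lambda>n. \<integral>\<^sup>+t. ennreal (\<phi> t * exp (d n * \<bar>t\<bar>)) \<partial>lborel) \<longlonglongrightarrow> (\<integral>\<^sup>+t. ennreal (\<phi> t) \<partial>lborel)"
  proof (rule nn_integral_dominated_convergence)
    show "(\<integral>\<^sup>+t. ennreal (\<phi> t * exp (c * \<bar>t\<bar>)) \<partial>lborel) < \<infinity>"
      using fin by (simp add: tilted_def)
    show "AE t in lborel. ennreal (\<phi> t * exp (d n * \<bar>t\<bar>)) \<le> ennreal (\<phi> t * exp (c * \<bar>t\<bar>))" for n
      using d \<phi>_pos by (intro AE_I2 ennreal_leI mult_left_mono) (auto intro: mult_right_mono less_imp_le)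
    have "(\<lambda>n. \<phi> t * exp (d n * \<bar>t\<bar>)) \<longlonglongrightarrow> \<phi> t * exp (0 * \<bar>t\<bar>)" for t
      by (intro tendsto_intros d)
    then show "AE t in lborel. (\<lambda>n. ennreal (\<phi> t * exp (d n * \<bar>t\<bar>))) \<longlonglongrightarrow> ennreal (\<phi> t)"
      by (intro AE_I2 tendsto_ennrealI) simp
  qed measurable
  then show ?thesis
    by (simp add: tilted_def \<phi>_int)
qed

text \<open>The test functions \<open>exp (- e \<bar>a x\<bar> / p)\<close> and \<open>exp (- e \<bar>b y\<bar> / q)\<close>. They are positive everywhere, so they are
admissible for negative exponents too (where they grow), and up to \<open>S\<^sub>a\<close> and \<open>S\<^sub>b\<close> their \<open>p\<close>-th and
\<open>q\<close>-th power integrals are the same number \<open>Z e\<close>, for every sign of \<open>p\<close> and \<open>q\<close>.\<close>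

definition test_F :: "real \<Rightarrow> real \<Rightarrow> 'a \<Rightarrow> real" where
  "test_F p e x = exp (- (e * \<bar>a x\<bar> / p))"

definition test_G :: "real \<Rightarrow> real \<Rightarrow> 'b \<Rightarrow> real" where
  "test_G q e y = exp (- (e * \<bar>b y\<bar> / q))"

lemma test_F_measurable [measurable]: "test_F p e \<in> borel_measurable M"
  and test_G_measurable [measurable]: "test_G q e \<in> borel_measurable N"
  unfolding test_F_def test_G_def by measurable

text \<open>The integral of \<open>exp (- e \<bar>t\<bar>)\<close> over the line. Its value cancels, only \<open>0 < Z e < \<infinity>\<close> matters.\<close>

definition Z :: "real \<Rightarrow> ennreal" where
  "Z e = (\<integral>\<^sup>+t. ennreal (exp (- (e * \<bar>t\<bar>))) \<partial>lborel)"

lemma norm_test_F: "p \<noteq> 0 \<Longrightarrow> (\<integral>\<^sup>+x. ennreal (test_F p e x) epowr p \<partial>M) = ennreal S\<^sub>a * Z e"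
  by (simp add: test_F_def epowr_ennreal powr_def Z_def
    nn_integral_a[of "\<lambda>t. ennreal (exp (- (e * \<bar>t\<bar>)))"])

lemma norm_test_G: "q \<noteq> 0 \<Longrightarrow> (\<integral>\<^sup>+y. ennreal (test_G q e y) epowr q \<partial>N) = ennreal S\<^sub>b * Z e"
  by (simp add: test_G_def epowr_ennreal powr_def Z_def
    nn_integral_b[of "\<lambda>t. ennreal (exp (- (e * \<bar>t\<bar>)))"])

lemma nn_integral_tilted:
  "(\<integral>\<^sup>+x. ennreal (\<phi> (a x - t) * exp (d * \<bar>a x - t\<bar>)) \<partial>M) = ennreal S\<^sub>a * tilted d"
proof -
  have "(\<integral>\<^sup>+x. ennreal (\<phi> (a x - t) * exp (d * \<bar>a x - t\<bar>)) \<partial>M)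
      = ennreal S\<^sub>a * (\<integral>\<^sup>+s. ennreal (\<phi> (s - t) * exp (d * \<bar>s - t\<bar>)) \<partial>lborel)"
    by (rule nn_integral_a) measurable
  also have "(\<integral>\<^sup>+s. ennreal (\<phi> (s - t) * exp (d * \<bar>s - t\<bar>)) \<partial>lborel) = tilted d"
    using nn_integral_real_affine[of "\<lambda>s. ennreal (\<phi> s * exp (d * \<bar>s\<bar>))" 1 "- t"]
    by (simp add: tilted_def)
  finally show ?thesis .
qed

text \<open>Since \<open>\<bar>\<bar>s\<bar> - \<bar>t\<bar>\<bar> \<le> \<bar>s - t\<bar>\<close>, replacing \<open>\<bar>a x\<bar>\<close> by \<open>\<bar>b y\<bar>\<close> in the test function costs a factor between
\<open>exp (- d \<bar>a x - b y\<bar>)\<close> and \<open>exp (d \<bar>a x - b y\<bar>)\<close> with \<open>d = e / \<bar>p\<bar>\<close>.\<close>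

lemma form_test_bounds:
  assumes p: "p \<noteq> 0" "1 / p + 1 / q = 1" and e: "0 < e"
  shows "(\<integral>\<^sup>+y. T (test_F p e) y * ennreal (test_G q e y) \<partial>N)
      \<le> ennreal (S\<^sub>a * S\<^sub>b) * tilted (e / \<bar>p\<bar>) * Z e" (is "?form \<le> _")
    and "ennreal (S\<^sub>a * S\<^sub>b) * tilted (- (e / \<bar>p\<bar>)) * Z e
      \<le> (\<integral>\<^sup>+y. T (test_F p e) y * ennreal (test_G q e y) \<partial>N)"
proof -
  define d where "d = e / \<bar>p\<bar>"
  \<comment> \<open>Bounds the change in the exponent when the coordinate s is replaced by t.\<close>
  have tri: "- (e * \<bar>s\<bar> / p) \<le> - (e * \<bar>t\<bar> / p) + d * \<bar>s - t\<bar>"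
    "- (e * \<bar>t\<bar> / p) - d * \<bar>s - t\<bar> \<le> - (e * \<bar>s\<bar> / p)" for s t
  proof -
    have "\<bar>e / p * (\<bar>s\<bar> - \<bar>t\<bar>)\<bar> = d * \<bar>\<bar>s\<bar> - \<bar>t\<bar>\<bar>"
      using e by (simp add: d_def abs_mult)
    also have "\<dots> \<le> d * \<bar>s - t\<bar>"
      using e by (intro mult_left_mono) (auto simp: d_def)
    finally have "\<bar>e * \<bar>s\<bar> / p - e * \<bar>t\<bar> / p\<bar> \<le> d * \<bar>s - t\<bar>"
      by (simp add: right_diff_distrib diff_divide_distrib)
    then show "- (e * \<bar>s\<bar> / p) \<le> - (e * \<bar>t\<bar> / p) + d * \<bar>s - t\<bar>"
      "- (e * \<bar>t\<bar> / p) - d * \<bar>s - t\<bar> \<le> - (e * \<bar>s\<bar> / p)" by linarith+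
  qed
  have merge: "exp (- (e * \<bar>t\<bar> / p)) * exp (- (e * \<bar>t\<bar> / q)) = exp (- (e * \<bar>t\<bar>))" for t
  proof -
    have "- (e * \<bar>t\<bar> / p) + - (e * \<bar>t\<bar> / q) = - (e * \<bar>t\<bar> * (1 / p + 1 / q))"
      by (simp add: algebra_simps)
    then show ?thesis by (simp only: p(2) flip: exp_add) simp
  qed
  have collect: "ennreal (exp (- (e * \<bar>b y\<bar> / p))) *
        (\<integral>\<^sup>+x. ennreal (\<phi> (a x - b y) * exp (c * \<bar>a x - b y\<bar>)) \<partial>M) * ennreal (test_G q e y)
      = ennreal S\<^sub>a * tilted c * ennreal (exp (- (e * \<bar>b y\<bar>)))" for y c
    unfolding nn_integral_tilted test_G_def merge[symmetric, of "b y"]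
    by (simp add: ennreal_mult' mult_ac)
  have total: "(\<integral>\<^sup>+y. ennreal S\<^sub>a * tilted c * ennreal (exp (- (e * \<bar>b y\<bar>))) \<partial>N)
      = ennreal (S\<^sub>a * S\<^sub>b) * tilted c * Z e" for c
    using S_pos nn_integral_b[of "\<lambda>t. ennreal (exp (- (e * \<bar>t\<bar>)))"]
    by (simp add: nn_integral_cmult Z_def ennreal_mult mult_ac)
  have "T (test_F p e) y \<le> ennreal (exp (- (e * \<bar>b y\<bar> / p))) *
      (\<integral>\<^sup>+x. ennreal (\<phi> (a x - b y) * exp (d * \<bar>a x - b y\<bar>)) \<partial>M)" for y
  proof -
    have "ennreal (\<phi> (a x - b y)) * ennreal (test_F p e x) \<le> ennreal (exp (- (e * \<bar>b y\<bar> / p))) *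
      ennreal (\<phi> (a x - b y) * exp (d * \<bar>a x - b y\<bar>))" for x
    proof -
      have "test_F p e x \<le> exp (- (e * \<bar>b y\<bar> / p)) * exp (d * \<bar>a x - b y\<bar>)"
        using tri(1)[of "a x" "b y"] by (simp add: test_F_def flip: exp_add)
      then have "\<phi> (a x - b y) * test_F p e x
          \<le> \<phi> (a x - b y) * (exp (- (e * \<bar>b y\<bar> / p)) * exp (d * \<bar>a x - b y\<bar>))"
        using \<phi>_pos by (intro mult_left_mono) (auto intro: less_imp_le)
      then have "ennreal (\<phi> (a x - b y) * test_F p e x)
          \<le> ennreal (exp (- (e * \<bar>b y\<bar> / p)) * (\<phi> (a x - b y) * exp (d * \<bar>a x - b y\<bar>)))"
        by (intro ennreal_leI) (simp add: mult_ac)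
      then show ?thesis
        using \<phi>_pos by (simp add: ennreal_mult less_imp_le test_F_def)
    qed
    then show ?thesis
      unfolding T_def by (subst nn_integral_cmult[symmetric]) (auto intro!: nn_integral_mono)
  qed
  then have "?form \<le> (\<integral>\<^sup>+y. ennreal (exp (- (e * \<bar>b y\<bar> / p))) *
      (\<integral>\<^sup>+x. ennreal (\<phi> (a x - b y) * exp (d * \<bar>a x - b y\<bar>)) \<partial>M) * ennreal (test_G q e y) \<partial>N)"
    by (intro nn_integral_mono mult_right_mono) auto
  then show "?form \<le> ennreal (S\<^sub>a * S\<^sub>b) * tilted (e / \<bar>p\<bar>) * Z e"
    unfolding collect total by (simp add: d_def)
  have "ennreal (exp (- (e * \<bar>b y\<bar> / p))) *
      (\<integral>\<^sup>+x. ennreal (\<phi> (a x - b y) * exp (- d * \<bar>a x - b y\<bar>)) \<partial>M) \<le> T (test_F p e) y" for y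
  proof -
    have "ennreal (exp (- (e * \<bar>b y\<bar> / p))) * ennreal (\<phi> (a x - b y) * exp (- d * \<bar>a x - b y\<bar>))
        \<le> ennreal (\<phi> (a x - b y)) * ennreal (test_F p e x)" for x
    proof -
      have "exp (- (e * \<bar>b y\<bar> / p)) * exp (- d * \<bar>a x - b y\<bar>) \<le> test_F p e x"
        using tri(2)[where s = "a x" and t = "b y"] by (simp add: test_F_def flip: exp_add)
      then have "\<phi> (a x - b y) * (exp (- (e * \<bar>b y\<bar> / p)) * exp (- d * \<bar>a x - b y\<bar>))
          \<le> \<phi> (a x - b y) * test_F p e x"
        using \<phi>_pos by (intro mult_left_mono) (auto intro: less_imp_le)
      then have "ennreal (exp (- (e * \<bar>b y\<bar> / p)) * (\<phi> (a x - b y) * exp (- d * \<bar>a x - b y\<bar>)))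
          \<le> ennreal (\<phi> (a x - b y) * test_F p e x)"
        by (intro ennreal_leI) (simp add: mult_ac)
      then show ?thesis
        using \<phi>_pos by (simp add: ennreal_mult less_imp_le test_F_def)
    qed
    then show ?thesis
      unfolding T_def by (subst nn_integral_cmult[symmetric]) (auto intro!: nn_integral_mono)
  qed
  then have "(\<integral>\<^sup>+y. ennreal (exp (- (e * \<bar>b y\<bar> / p))) *
      (\<integral>\<^sup>+x. ennreal (\<phi> (a x - b y) * exp (- d * \<bar>a x - b y\<bar>)) \<partial>M) * ennreal (test_G q e y) \<partial>N) \<le> ?form"
    by (intro nn_integral_mono mult_right_mono) auto
  then show "ennreal (S\<^sub>a * S\<^sub>b) * tilted (- (e / \<bar>p\<bar>)) * Z e \<le> ?form"
    unfolding collect total by (simp add: d_def)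
qed

lemma norms_test:
  assumes p: "p \<noteq> 0" "q \<noteq> 0" "1 / p + 1 / q = 1" and e: "0 < e"
  obtains z where "0 < z" "Z e = ennreal z"
    "(\<integral>\<^sup>+x. ennreal (test_F p e x) epowr p \<partial>M) epowr (1 / p) *
     (\<integral>\<^sup>+y. ennreal (test_G q e y) epowr q \<partial>N) epowr (1 / q)
     = ennreal (S\<^sub>a powr (1 / p) * S\<^sub>b powr (1 / q) * z)"
proof -
  obtain z where z: "0 < z" "Z e = ennreal z"
    using nn_integral_exp_minus_abs_pos[OF e] by (auto simp: Z_def)
  have "(ennreal S\<^sub>a * Z e) epowr (1 / p) * (ennreal S\<^sub>b * Z e) epowr (1 / q)
      = ennreal (S\<^sub>a powr (1 / p) * S\<^sub>b powr (1 / q) * (z powr (1 / p) * z powr (1 / q)))"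
    using S_pos z by (simp add: epowr_mult_ennreal epowr_ennreal ennreal_mult mult_ac)
  also have "z powr (1 / p) * z powr (1 / q) = z"
    using z p by (simp flip: powr_add)
  finally show thesis
    using that z p by (simp add: norm_test_F norm_test_G)
qed

lemma best_split:
  assumes "1 / p + 1 / q = 1"
  shows "S\<^sub>a * S\<^sub>b * k = S\<^sub>a powr (1 / p) * S\<^sub>b powr (1 / q) * best p q"
proof -
  have "S\<^sub>a powr (1 / p) * S\<^sub>a powr (1 / q) = S\<^sub>a" "S\<^sub>b powr (1 / p) * S\<^sub>b powr (1 / q) = S\<^sub>b"
    using S_pos assms by (simp_all flip: powr_add)
  then have "S\<^sub>a * S\<^sub>b * k = (S\<^sub>a powr (1 / p) * S\<^sub>a powr (1 / q)) * (S\<^sub>b powr (1 / p) * S\<^sub>b powr (1 / q)) * k"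
    by simp
  then show ?thesis
    by (simp add: best_def mult_ac)
qed

lemma best_le_if_form_le:
  assumes p: "p \<noteq> 0" "q \<noteq> 0" "1 / p + 1 / q = 1" and C: "0 \<le> C"
    and bound: "\<And>e. 0 < e \<Longrightarrow> (\<integral>\<^sup>+y. T (test_F p e) y * ennreal (test_G q e y) \<partial>N)
      \<le> ennreal C * ((\<integral>\<^sup>+x. ennreal (test_F p e x) epowr p \<partial>M) epowr (1 / p) *
        (\<integral>\<^sup>+y. ennreal (test_G q e y) epowr q \<partial>N) epowr (1 / q))"
  shows "best p q \<le> C"
proof -
  let ?P = "S\<^sub>a powr (1 / p) * S\<^sub>b powr (1 / q)"
  define B where "B = C * ?P / (S\<^sub>a * S\<^sub>b)"
  have B: "0 \<le> B" using C S_pos by (simp add: B_def)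
  have tilted_le: "tilted (- (e / \<bar>p\<bar>)) \<le> ennreal B" if e: "0 < e" for e
  proof -
    obtain z where z: "0 < z" "Z e = ennreal z"
      "(\<integral>\<^sup>+x. ennreal (test_F p e x) epowr p \<partial>M) epowr (1 / p) *
       (\<integral>\<^sup>+y. ennreal (test_G q e y) epowr q \<partial>N) epowr (1 / q) = ennreal (?P * z)"
      by (rule norms_test[OF p e])
    have "ennreal (S\<^sub>a * S\<^sub>b) * tilted (- (e / \<bar>p\<bar>)) * ennreal z \<le> ennreal C * ennreal (?P * z)"
      using form_test_bounds(2)[OF p(1,3) e] bound[OF e] unfolding z by (rule order_trans)
    also have "\<dots> = ennreal (S\<^sub>a * S\<^sub>b * z * B)"
      using C S_pos z by (simp add: B_def mult_ac flip: ennreal_mult)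
    also have "\<dots> = ennreal (S\<^sub>a * S\<^sub>b * z) * ennreal B"
      using S_pos z B by (simp add: ennreal_mult)
    finally have "ennreal (S\<^sub>a * S\<^sub>b * z) * tilted (- (e / \<bar>p\<bar>)) \<le> ennreal (S\<^sub>a * S\<^sub>b * z) * ennreal B"
      using S_pos z by (simp add: ennreal_mult mult_ac)
    then show ?thesis
      using S_pos z by (subst (asm) ennreal_mult_le_mult_iff) auto
  qed
  have "(\<lambda>n. tilted (- inverse (real (Suc n)))) \<longlonglongrightarrow> ennreal k"
  proof (rule tilted_tendsto[where c = 0])
    show "(\<lambda>n. - inverse (real (Suc n))) \<longlonglongrightarrow> 0"
      using tendsto_minus[OF LIMSEQ_inverse_real_of_nat] by simp
    show "tilted 0 < \<infinity>" by (simp add: tilted_def \<phi>_int)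
  qed auto
  moreover have "tilted (- inverse (real (Suc n))) \<le> ennreal B" for n
    using tilted_le[of "\<bar>p\<bar> * inverse (real (Suc n))"] p by simp
  ultimately have "ennreal k \<le> ennreal B"
    by (intro LIMSEQ_le_const2) auto
  then have "S\<^sub>a * S\<^sub>b * k \<le> C * ?P"
    using B S_pos by (simp add: B_def field_simps)
  then show ?thesis
    unfolding best_split[OF p(3)] using S_pos by (simp add: mult.commute[of C])
qed

lemma best_ge_if_form_ge:
  assumes p: "p \<noteq> 0" "q \<noteq> 0" "1 / p + 1 / q = 1" and C: "0 \<le> C"
    and c0: "0 < c0" "tilted c0 < \<infinity>"
    and bound: "\<And>e. 0 < e \<Longrightarrow> ennreal C * ((\<integral>\<^sup>+x. ennreal (test_F p e x) epowr p \<partial>M) epowr (1 / p) *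
        (\<integral>\<^sup>+y. ennreal (test_G q e y) epowr q \<partial>N) epowr (1 / q))
      \<le> (\<integral>\<^sup>+y. T (test_F p e) y * ennreal (test_G q e y) \<partial>N)"
  shows "C \<le> best p q"
proof -
  let ?P = "S\<^sub>a powr (1 / p) * S\<^sub>b powr (1 / q)"
  define B where "B = C * ?P / (S\<^sub>a * S\<^sub>b)"
  have B: "0 \<le> B" using C S_pos by (simp add: B_def)
  have le_tilted: "ennreal B \<le> tilted (e / \<bar>p\<bar>)" if e: "0 < e" for e
  proof -
    obtain z where z: "0 < z" "Z e = ennreal z"
      "(\<integral>\<^sup>+x. ennreal (test_F p e x) epowr p \<partial>M) epowr (1 / p) *
       (\<integral>\<^sup>+y. ennreal (test_G q e y) epowr q \<partial>N) epowr (1 / q) = ennreal (?P * z)"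
      by (rule norms_test[OF p e])
    have "ennreal (S\<^sub>a * S\<^sub>b * z) * ennreal B = ennreal (S\<^sub>a * S\<^sub>b * z * B)"
      using S_pos z B by (simp add: ennreal_mult)
    also have "\<dots> = ennreal C * ennreal (?P * z)"
      using C S_pos z by (simp add: B_def mult_ac flip: ennreal_mult)
    also have "\<dots> \<le> ennreal (S\<^sub>a * S\<^sub>b) * tilted (e / \<bar>p\<bar>) * ennreal z"
      using bound[OF e] form_test_bounds(1)[OF p(1,3) e] unfolding z by (rule order_trans)
    finally have "ennreal (S\<^sub>a * S\<^sub>b * z) * ennreal B \<le> ennreal (S\<^sub>a * S\<^sub>b * z) * tilted (e / \<bar>p\<bar>)"
      using S_pos z by (simp add: ennreal_mult mult_ac)
    then show ?thesis
      using S_pos z by (subst (asm) ennreal_mult_le_mult_iff) auto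
  qed
  have "(\<lambda>n. tilted (c0 * inverse (real (Suc n)))) \<longlonglongrightarrow> ennreal k"
  proof (rule tilted_tendsto[where c = c0])
    show "(\<lambda>n. c0 * inverse (real (Suc n))) \<longlonglongrightarrow> 0"
      using tendsto_mult_left[OF LIMSEQ_inverse_real_of_nat, of c0] by simp
    show "c0 * inverse (real (Suc n)) \<le> c0" for n
      using c0 by (simp add: field_simps)
  qed fact
  moreover have "ennreal B \<le> tilted (c0 * inverse (real (Suc n)))" for n
    using le_tilted[of "\<bar>p\<bar> * (c0 * inverse (real (Suc n)))"] p c0 by simp
  ultimately have "ennreal B \<le> ennreal k"
    by (intro LIMSEQ_le_const) auto
  then have "C * ?P \<le> S\<^sub>a * S\<^sub>b * k"
    using k_pos S_pos by (simp add: B_def field_simps)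
  then show ?thesis
    unfolding best_split[OF p(3)] using S_pos by (simp add: mult.commute[of C])
qed

end

section \<open>The distribution of the logarithm of a radius\<close>

text \<open>If the sublevel sets of \<open>r\<close> have measure \<open>V t powr m\<close>, then \<open>- ln r\<close> has density \<open>m V exp (- m s)\<close>. The sign makes
the sets \<open>{x. - ln (r x) > s}\<close> of finite measure, and these determine the distribution.\<close>

lemma distr_minus_ln:
  fixes r :: "'a \<Rightarrow> real"
  assumes r[measurable]: "r \<in> borel_measurable M" and r_pos: "\<And>x. x \<in> space M \<Longrightarrow> 0 < r x"
    and m: "0 < m" and V: "0 \<le> V"
    and vol: "\<And>t. 0 < t \<Longrightarrow> emeasure M {x \<in> space M. r x < t} = ennreal (V * t powr m)"
  shows "distr M borel (\<lambda>x. - ln (r x)) = density lborel (\<lambda>s. ennreal (m * V * exp (- (m * s))))"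
proof (rule measure_eqI_lessThan)
  have D: "emeasure (distr M borel (\<lambda>x. - ln (r x))) {s<..} = ennreal (V * exp (- (m * s)))" for s
  proof -
    have "s < - ln u \<longleftrightarrow> u < exp (- s)" if "0 < u" for u
      using that by (metis exp_less_cancel_iff exp_ln less_minus_iff)
    then have "(\<lambda>x. - ln (r x)) -` {s<..} \<inter> space M = {x \<in> space M. r x < exp (- s)}"
      using r_pos by auto
    then show ?thesis
      using vol[of "exp (- s)"] by (simp add: emeasure_distr powr_def)
  qed
  then show "emeasure (distr M borel (\<lambda>x. - ln (r x))) {s<..} < \<infinity>" for s
    by simp
  show "emeasure (distr M borel (\<lambda>x. - ln (r x))) {s<..}
      = emeasure (density lborel (\<lambda>s. ennreal (m * V * exp (- (m * s))))) {s<..}" for s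
  proof -
    have "((\<lambda>t. - V * exp (- (m * t))) \<longlongrightarrow> - V * 0) at_top"
      using m by (intro tendsto_intros) real_asymp
    then have "(\<integral>\<^sup>+t. ennreal (m * V * exp (- (m * t))) * indicator {s..} t \<partial>lborel) = ennreal (V * exp (- (m * s)))"
      using m V
      by (subst nn_integral_FTC_atLeast[where F = "\<lambda>t. - V * exp (- (m * t))" and T = 0])
         (auto intro!: derivative_eq_intros)
    moreover have "(\<integral>\<^sup>+t. ennreal (m * V * exp (- (m * t))) * indicator {s..} t \<partial>lborel)
        = (\<integral>\<^sup>+t. ennreal (m * V * exp (- (m * t))) * indicator {s<..} t \<partial>lborel)"
      by (intro nn_integral_cong_AE, use AE_lborel_singleton[of s] in eventually_elim)
         (auto split: split_indicator)
    ultimately show ?thesis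
      unfolding D by (simp add: emeasure_density)
  qed
qed simp_all

lemma nn_integral_minus_ln:
  fixes r :: "'a \<Rightarrow> real"
  assumes "r \<in> borel_measurable M" "\<And>x. x \<in> space M \<Longrightarrow> 0 < r x" "0 < m" "0 \<le> V"
    and "\<And>t. 0 < t \<Longrightarrow> emeasure M {x \<in> space M. r x < t} = ennreal (V * t powr m)"
    and [measurable]: "\<psi> \<in> borel_measurable borel"
  shows "(\<integral>\<^sup>+x. \<psi> (- ln (r x)) \<partial>M) = (\<integral>\<^sup>+s. ennreal (m * V * exp (- (m * s))) * \<psi> s \<partial>lborel)"
proof -
  have [measurable]: "r \<in> borel_measurable M" by fact
  have "(\<integral>\<^sup>+x. \<psi> (- ln (r x)) \<partial>M) = (\<integral>\<^sup>+s. \<psi> s \<partial>distr M borel (\<lambda>x. - ln (r x)))"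
    by (simp add: nn_integral_distr)
  also have "\<dots> = (\<integral>\<^sup>+s. ennreal (m * V * exp (- (m * s))) * \<psi> s \<partial>lborel)"
    by (subst distr_minus_ln[OF assms(1-5)]) (auto simp: nn_integral_density)
  finally show ?thesis .
qed

text \<open>The substitution \<open>u = exp (- s)\<close>: the case where \<open>r\<close> is the identity on the half-line.\<close>

lemma nn_integral_pos_exp_subst:
  assumes [measurable]: "h \<in> borel_measurable borel"
  shows "(\<integral>\<^sup>+u. h u * indicator {0<..} u \<partial>lborel)
    = (\<integral>\<^sup>+s. ennreal (exp (- s)) * h (exp (- s)) \<partial>lborel)"
proof -
  let ?M = "restrict_space lborel {0<..} :: real measure"
  have "(\<integral>\<^sup>+u. h (exp (- (- ln u))) \<partial>?M)
      = (\<integral>\<^sup>+s. ennreal (1 * 1 * exp (- (1 * s))) * h (exp (- s)) \<partial>lborel)"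
  proof (rule nn_integral_minus_ln)
    show "(\<lambda>u. u) \<in> borel_measurable ?M"
      by (intro measurable_restrict_space1) simp
    show "emeasure ?M {x \<in> space ?M. x < t} = ennreal (1 * t powr 1)" if "0 < t" for t
    proof -
      have "{x \<in> space ?M. x < t} = {0<..<t}" by (auto simp: space_restrict_space)
      then show ?thesis using that by (subst emeasure_restrict_space) auto
    qed
  qed (auto simp: space_restrict_space)
  moreover have "(\<integral>\<^sup>+u. h (exp (- (- ln u))) \<partial>?M) = (\<integral>\<^sup>+u. h u * indicator {0<..} u \<partial>lborel)"
    by (subst nn_integral_restrict_space) (auto intro!: nn_integral_cong split: split_indicator)
  ultimately show ?thesis by simp
qed

lemma nn_integral_Gamma_log:
  assumes "0 < s" "0 < \<alpha>" "0 < c"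
  shows "(\<integral>\<^sup>+t. ennreal (exp (- (s * t)) * exp (- (c * exp (- (\<alpha> * t))))) \<partial>lborel)
    = ennreal (Gamma (s / \<alpha>) * c powr (- (s / \<alpha>)) / \<alpha>)"
proof -
  define z where "z = s / \<alpha>"
  have z: "0 < z" "z * \<alpha> = s" using assms by (auto simp: z_def)
  let ?g = "\<lambda>t. ennreal (exp (- (z * t)) * exp (- exp (- t)))"
  have "ennreal (Gamma z) = (\<integral>\<^sup>+u. ennreal (indicator {0..} u * u powr (z - 1) / exp u) \<partial>lborel)"
    using z by (intro Gamma_conv_nn_integral_real)
  also have "\<dots> = (\<integral>\<^sup>+u. ennreal (u powr (z - 1) / exp u) * indicator {0<..} u \<partial>lborel)"
    by (intro nn_integral_cong) (auto split: split_indicator)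
  also have "\<dots> = (\<integral>\<^sup>+t. ennreal (exp (- t)) * ennreal (exp (- t) powr (z - 1) / exp (exp (- t))) \<partial>lborel)"
    by (rule nn_integral_pos_exp_subst) measurable
  also have "\<dots> = (\<integral>\<^sup>+t. ?g t \<partial>lborel)"
  proof (intro nn_integral_cong)
    fix t :: real
    have "exp (- t) * exp (- t) powr (z - 1) = exp (- (z * t))"
      by (simp add: powr_def algebra_simps flip: exp_add)
    then show "ennreal (exp (- t)) * ennreal (exp (- t) powr (z - 1) / exp (exp (- t))) = ?g t"
      by (simp add: exp_minus[of "exp (- t)"] divide_inverse mult.assoc[symmetric] flip: ennreal_mult)
  qed
  also have "\<dots> = ennreal \<alpha> * (\<integral>\<^sup>+t. ?g (- ln c + \<alpha> * t) \<partial>lborel)"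
    using assms by (subst nn_integral_real_affine[where c = \<alpha> and t = "- ln c"]) auto
  also have "(\<integral>\<^sup>+t. ?g (- ln c + \<alpha> * t) \<partial>lborel)
      = (\<integral>\<^sup>+t. ennreal (c powr z) * ennreal (exp (- (s * t)) * exp (- (c * exp (- (\<alpha> * t))))) \<partial>lborel)"
  proof (intro nn_integral_cong)
    fix t :: real
    have "exp (- (z * (- ln c + \<alpha> * t))) = c powr z * exp (- (s * t))"
      using assms z(2) by (simp add: powr_def algebra_simps flip: exp_add)
    moreover have "exp (- (- ln c + \<alpha> * t)) = c * exp (- (\<alpha> * t))"
      using assms by (simp add: exp_diff exp_minus field_simps)
    ultimately show "?g (- ln c + \<alpha> * t)
        = ennreal (c powr z) * ennreal (exp (- (s * t)) * exp (- (c * exp (- (\<alpha> * t)))))"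
      by (simp add: mult.assoc flip: ennreal_mult)
  qed
  also have "\<dots> = ennreal (c powr z) * (\<integral>\<^sup>+t. ennreal (exp (- (s * t)) * exp (- (c * exp (- (\<alpha> * t))))) \<partial>lborel)"
    (is "_ = _ * ?I")
    by (rule nn_integral_cmult) measurable
  finally have *: "ennreal (Gamma z) = ennreal (\<alpha> * c powr z) * ?I"
    using assms by (simp add: ennreal_mult mult.assoc)
  have "?I = ennreal (inverse (\<alpha> * c powr z)) * (ennreal (\<alpha> * c powr z) * ?I)"
  proof -
    have "ennreal (inverse (\<alpha> * c powr z)) * ennreal (\<alpha> * c powr z) = 1"
      using assms by (simp del: inverse_mult_distrib flip: ennreal_mult)
    then show ?thesis by (simp only: mult.assoc[symmetric] mult_1)
  qed
  also have "\<dots> = ennreal (inverse (\<alpha> * c powr z) * Gamma z)"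
    unfolding *[symmetric] using assms by (intro ennreal_mult'[symmetric]) simp
  also have "inverse (\<alpha> * c powr z) * Gamma z = Gamma z * c powr (- z) / \<alpha>"
    by (simp add: powr_minus field_simps)
  finally show ?thesis
    by (simp add: z_def)
qed

section \<open>The norm on the positive orthant\<close>

lemma norm_exp_measurable [measurable]: "norm_exp \<alpha> \<in> borel_measurable borel"
  unfolding norm_exp_def by measurable

lemma norm_exp_pos:
  assumes "x \<in> pos_orthant"
  shows "0 < norm_exp \<alpha> x"
proof -
  have "0 < (\<Sum>k\<in>UNIV. \<bar>x $ k\<bar> powr \<alpha>)"
    using assms by (intro sum_pos) (auto simp: pos_orthant_def, metis less_irrefl)
  then show ?thesis by (simp add: norm_exp_def)
qed

lemma norm_exp_powr: "\<alpha> \<noteq> 0 \<Longrightarrow> norm_exp \<alpha> x powr \<alpha> = (\<Sum>k\<in>UNIV. \<bar>x $ k\<bar> powr \<alpha>)"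
  by (simp add: norm_exp_def powr_powr sum_nonneg)

lemma norm_exp_scaleR:
  assumes "0 \<le> t" "\<alpha> \<noteq> 0"
  shows "norm_exp \<alpha> (t *\<^sub>R x) = t * norm_exp \<alpha> x"
proof -
  have "(\<Sum>k\<in>UNIV. \<bar>(t *\<^sub>R x) $ k\<bar> powr \<alpha>) = t powr \<alpha> * (\<Sum>k\<in>UNIV. \<bar>x $ k\<bar> powr \<alpha>)"
    using assms by (simp add: abs_mult powr_mult sum_distrib_left)
  then show ?thesis
    using assms by (simp add: norm_exp_def powr_mult sum_nonneg powr_powr)
qed

lemma abs_component_le_norm_exp:
  assumes "0 < \<alpha>"
  shows "\<bar>x $ k\<bar> \<le> norm_exp \<alpha> x"
proof -
  have "\<bar>x $ k\<bar> powr \<alpha> \<le> (\<Sum>k\<in>UNIV. \<bar>x $ k\<bar> powr \<alpha>)"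
    by (intro member_le_sum) auto
  then have "(\<bar>x $ k\<bar> powr \<alpha>) powr (1 / \<alpha>) \<le> norm_exp \<alpha> x"
    unfolding norm_exp_def using assms by (intro powr_mono2) auto
  then show ?thesis using assms by (simp add: powr_powr)
qed

lemma pos_orthant_borel [measurable]: "(pos_orthant :: (real ^ 'd) set) \<in> sets borel"
proof -
  have "(pos_orthant :: (real ^ 'd) set) = (\<Inter>k. {x. 0 < x $ k})"
    by (auto simp: pos_orthant_def)
  also have "\<dots> \<in> sets borel"
    by (intro sets.finite_INT) (auto intro!: borel_open open_Collect_less continuous_intros)
  finally show ?thesis .
qed

lemma nn_integral_orthant:
  fixes h :: "real ^ 'd \<Rightarrow> ennreal"
  shows "(\<integral>\<^sup>+x. h x \<partial>orthant_measure) = (\<integral>\<^sup>+x. h x * indicator pos_orthant x \<partial>lborel)"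
  by (subst nn_integral_restrict_space) (auto simp: nn_integral_completion)

text \<open>The integrand is a product of functions of one coordinate each.\<close>

lemma nn_integral_exp_norm_exp:
  assumes "0 < \<alpha>"
  shows "(\<integral>\<^sup>+x. ennreal (exp (- (norm_exp \<alpha> x powr \<alpha>))) \<partial>(orthant_measure :: (real ^ 'd) measure))
    = ennreal ((Gamma (1 / \<alpha>) / \<alpha>) ^ CARD('d))"
proof -
  let ?f = "\<lambda>u. exp (- (\<bar>u\<bar> powr \<alpha>)) * indicator {0<..} u :: real"
  have "ennreal (exp (- (norm_exp \<alpha> x powr \<alpha>))) * indicator pos_orthant x
      = (\<Prod>b\<in>Basis. ennreal (?f (x \<bullet> b)))" for x :: "real ^ 'd"
  proof -
    have "(\<Prod>b\<in>Basis. ?f (x \<bullet> b)) = (\<Prod>k\<in>UNIV. ?f (x $ k))"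
      by (simp add: Basis_vec_def prod.UNION_disjoint axis_eq_axis inner_axis prod.reindex inj_on_def image_image
            UNION_singleton_eq_range)
    also have "\<dots> = exp (- (norm_exp \<alpha> x powr \<alpha>)) * indicator pos_orthant x"
    proof -
      have "(\<Prod>k\<in>UNIV. indicator {0<..} (x $ k) :: real) = indicator pos_orthant x"
        by (auto simp: pos_orthant_def indicator_def prod_zero_iff)
      then show ?thesis
        using assms by (simp add: prod.distrib norm_exp_powr sum_negf exp_sum flip: sum_negf)
    qed
    finally have eq: "(\<Prod>b\<in>Basis. ?f (x \<bullet> b)) = exp (- (norm_exp \<alpha> x powr \<alpha>)) * indicator pos_orthant x" .
    have "(\<Prod>b\<in>Basis. ennreal (?f (x \<bullet> b))) = ennreal (\<Prod>b\<in>Basis. ?f (x \<bullet> b))"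
      by (rule prod_ennreal) simp
    then show ?thesis
      unfolding eq by (simp split: split_indicator)
  qed
  then have "(\<integral>\<^sup>+x. ennreal (exp (- (norm_exp \<alpha> x powr \<alpha>))) \<partial>(orthant_measure :: (real ^ 'd) measure))
      = (\<integral>\<^sup>+x. (\<Prod>b\<in>Basis. ennreal (?f (x \<bullet> b))) \<partial>(lborel :: (real ^ 'd) measure))"
    by (simp add: nn_integral_orthant)
  also have "\<dots> = (\<Prod>b\<in>(Basis :: (real ^ 'd) set). (\<integral>\<^sup>+u. ennreal (?f u) \<partial>lborel))"
    by (rule nn_integral_lborel_prod) auto
  also have "(\<integral>\<^sup>+u. ennreal (?f u) \<partial>lborel) = (\<integral>\<^sup>+u. ennreal (exp (- (\<bar>u\<bar> powr \<alpha>))) * indicator {0<..} u \<partial>lborel)"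
    by (intro nn_integral_cong) (auto split: split_indicator)
  also have "\<dots> = (\<integral>\<^sup>+s. ennreal (exp (- s)) * ennreal (exp (- (\<bar>exp (- s)\<bar> powr \<alpha>))) \<partial>lborel)"
    by (rule nn_integral_pos_exp_subst) measurable
  also have "\<dots> = (\<integral>\<^sup>+s. ennreal (exp (- (1 * s)) * exp (- (1 * exp (- (\<alpha> * s))))) \<partial>lborel)"
    by (simp add: powr_def flip: ennreal_mult)
  also have "\<dots> = ennreal (Gamma (1 / \<alpha>) / \<alpha>)"
    using assms by (subst nn_integral_Gamma_log) auto
  finally show ?thesis
    using assms Gamma_real_pos[of "1 / \<alpha>"] by (simp add: ennreal_power)
qed

text \<open>The constant in polar coordinates for the \<open>\<alpha>\<close>-norm on the positive orthant of dimension \<open>m\<close>: the integral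
of a radial function \<open>\<psi> (norm_exp \<alpha> x)\<close> is \<open>sphere_const m \<alpha>\<close> times the integral of \<open>\<psi> u * u ^ (m - 1)\<close>
over \<open>u > 0\<close>.\<close>

definition sphere_const :: "nat \<Rightarrow> real \<Rightarrow> real" where
  "sphere_const m \<alpha> = Gamma (1 / \<alpha>) ^ m / (\<alpha> ^ (m - 1) * Gamma (real m / \<alpha>))"

lemma sphere_const_pos: "0 < \<alpha> \<Longrightarrow> 0 < m \<Longrightarrow> 0 < sphere_const m \<alpha>"
  by (auto simp: sphere_const_def intro!: divide_pos_pos mult_pos_pos Gamma_real_pos)

text \<open>By scaling the volume is \<open>V\<close> times a power of \<open>t\<close>. The factor \<open>V\<close> is found by computing the integral of
\<open>exp (- norm_exp \<alpha> x powr \<alpha>)\<close> in two ways: as a product over the coordinates, and radially.\<close>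

lemma emeasure_norm_exp_less:
  assumes \<alpha>: "0 < \<alpha>" and t: "0 < t"
  shows "emeasure orthant_measure {x \<in> space (orthant_measure :: (real ^ 'd) measure). norm_exp \<alpha> x < t}
    = ennreal (sphere_const CARD('d) \<alpha> / real CARD('d) * t powr real CARD('d))"
proof -
  let ?O = "orthant_measure :: (real ^ 'd) measure" and ?d = "real CARD('d)"
  define ball where "ball t = {x :: real ^ 'd. x \<in> pos_orthant \<and> norm_exp \<alpha> x < t}" for t
  have [measurable]: "ball t \<in> sets borel" for t
    unfolding ball_def by measurable
  have emeasure_O: "emeasure ?O {x \<in> space ?O. norm_exp \<alpha> x < t} = emeasure lborel (ball t)" for t
  proof -
    have "{x \<in> space ?O. norm_exp \<alpha> x < t} = ball t" by (auto simp: ball_def)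
    moreover have "ball t \<subseteq> pos_orthant" by (auto simp: ball_def)
    ultimately show ?thesis
      by (simp add: emeasure_restrict_space emeasure_completion main_part_sets)
  qed
  have scale: "emeasure lborel (ball t) = ennreal (t ^ CARD('d)) * emeasure lborel (ball 1)" if "0 < t" for t
  proof -
    have "(*\<^sub>R) t ` ball 1 = ball t"
    proof
      show "(*\<^sub>R) t ` ball 1 \<subseteq> ball t"
        using that \<alpha> by (auto simp: ball_def pos_orthant_def norm_exp_scaleR)
      show "ball t \<subseteq> (*\<^sub>R) t ` ball 1"
      proof
        fix x assume "x \<in> ball t"
        then have "inverse t *\<^sub>R x \<in> ball 1"
          using that \<alpha> by (auto simp: ball_def pos_orthant_def norm_exp_scaleR field_simps)
        moreover have "x = t *\<^sub>R (inverse t *\<^sub>R x)" using that by simp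
        ultimately show "x \<in> (*\<^sub>R) t ` ball 1" by blast
      qed
    qed
    then have "emeasure lborel (ball t) = emeasure lebesgue ((*\<^sub>R) t ` ball 1)"
      by (simp add: emeasure_completion main_part_sets)
    also have "\<dots> = emeasure lebesgue ((\<lambda>x. 0 + t *\<^sub>R x) ` ball 1)" by simp
    also have "\<dots> = ennreal (t ^ CARD('d)) * emeasure lborel (ball 1)"
      using that emeasure_lebesgue_affine[of t 0 "ball 1"]
      by (simp add: emeasure_completion main_part_sets image_image)
    finally show ?thesis .
  qed
  have "emeasure lborel (ball 1) \<le> emeasure lborel (cbox (- 1 :: real ^ 'd) 1)"
  proof (rule emeasure_mono)
    have "\<bar>x $ k\<bar> < 1" if "norm_exp \<alpha> x < 1" for x :: "real ^ 'd" and k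
      using abs_component_le_norm_exp[OF \<alpha>, of x k] that by linarith
    then have "- 1 \<le> x $ k \<and> x $ k \<le> 1" if "norm_exp \<alpha> x < 1" for x :: "real ^ 'd" and k
      using that by (fastforce simp: abs_less_iff intro: less_imp_le)
    then show "ball 1 \<subseteq> cbox (- 1 :: real ^ 'd) 1"
      by (simp add: ball_def mem_box_cart subset_iff)
  qed simp
  also have "\<dots> < \<infinity>" by (rule emeasure_lborel_cbox_finite)
  finally obtain V where V: "0 \<le> V" "emeasure lborel (ball 1) = ennreal V"
    by (cases "emeasure lborel (ball 1)") auto
  have vol: "emeasure ?O {x \<in> space ?O. norm_exp \<alpha> x < t} = ennreal (V * t powr ?d)" if "0 < t" for t
    unfolding emeasure_O scale[OF that] V(2) using that V(1)
    by (simp add: powr_realpow mult.commute flip: ennreal_mult)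
  have [measurable]: "norm_exp \<alpha> \<in> borel_measurable ?O"
    by (intro measurable_restrict_space1 measurable_completion) simp
  have "ennreal ((Gamma (1 / \<alpha>) / \<alpha>) ^ CARD('d)) = (\<integral>\<^sup>+x. ennreal (exp (- (norm_exp \<alpha> x powr \<alpha>))) \<partial>?O)"
    by (rule nn_integral_exp_norm_exp[OF \<alpha>, symmetric])
  also have "\<dots> = (\<integral>\<^sup>+x. ennreal (exp (- (exp (- (\<alpha> * (- ln (norm_exp \<alpha> x))))))) \<partial>?O)"
    by (intro nn_integral_cong) (auto simp: powr_def dest: norm_exp_pos[of _ \<alpha>])
  also have "\<dots> = (\<integral>\<^sup>+s. ennreal (?d * V * exp (- (?d * s))) * ennreal (exp (- (exp (- (\<alpha> * s))))) \<partial>lborel)"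
    by (rule nn_integral_minus_ln) (use V vol in \<open>auto intro: norm_exp_pos\<close>)
  also have "\<dots> = (\<integral>\<^sup>+s. ennreal (?d * V) * ennreal (exp (- (?d * s)) * exp (- (1 * exp (- (\<alpha> * s))))) \<partial>lborel)"
    using V by (simp add: mult.assoc flip: ennreal_mult)
  also have "\<dots> = ennreal (?d * V) * ennreal (Gamma (?d / \<alpha>) / \<alpha>)"
  proof -
    have "(\<integral>\<^sup>+s. ennreal (exp (- (?d * s)) * exp (- (1 * exp (- (\<alpha> * s))))) \<partial>lborel) = ennreal (Gamma (?d / \<alpha>) / \<alpha>)"
      using \<alpha> by (subst nn_integral_Gamma_log) auto
    then show ?thesis
      by (subst nn_integral_cmult) auto
  qed
  also have "\<dots> = ennreal (?d * V * Gamma (?d / \<alpha>) / \<alpha>)"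
    using V \<alpha> Gamma_real_pos[of "?d / \<alpha>"] by (simp flip: ennreal_mult)
  finally have "(Gamma (1 / \<alpha>) / \<alpha>) ^ CARD('d) = ?d * V * Gamma (?d / \<alpha>) / \<alpha>"
    using V \<alpha> Gamma_real_pos[of "?d / \<alpha>"] Gamma_real_pos[of "1 / \<alpha>"] by (subst (asm) ennreal_inj) auto
  moreover have "\<alpha> ^ CARD('d) = \<alpha> * \<alpha> ^ (CARD('d) - 1)"
    by (rule power_eq_if[THEN trans]) simp
  ultimately have "Gamma (1 / \<alpha>) ^ CARD('d) / \<alpha> ^ (CARD('d) - 1) = ?d * V * Gamma (?d / \<alpha>)"
    using \<alpha> by (simp add: power_divide divide_simps)
  moreover have "0 < Gamma (?d / \<alpha>)"
    using \<alpha> by (intro Gamma_real_pos) simp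
  ultimately have "V = sphere_const CARD('d) \<alpha> / ?d"
    by (simp add: sphere_const_def flip: divide_divide_eq_left)
  then show ?thesis
    using vol[OF t] by simp
qed

section \<open>The hyperbolic cotangent kernel\<close>

lemma coth_minus_1: "0 < u \<Longrightarrow> coth u - 1 = 2 * exp (- (2 * u)) / (1 - exp (- (2 * u)))"
proof -
  assume u: "0 < u"
  have e: "exp (- (2 * u)) = exp (- u) * exp (- u)" "exp u * exp (- u) = 1"
    by (simp_all flip: exp_add)
  have "exp u - exp (- u) \<noteq> 0" "1 - exp (- (2 * u)) \<noteq> 0"
    using u by auto
  moreover have "2 * exp (- u) * (1 - exp (- (2 * u))) = 2 * exp (- (2 * u)) * (exp u - exp (- u))"
    using e by (simp add: algebra_simps)
  moreover have "coth u - 1 = 2 * exp (- u) / (exp u - exp (- u))"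
    using \<open>exp u - exp (- u) \<noteq> 0\<close> by (simp add: coth_def field_simps)
  ultimately show ?thesis
    by (simp add: frac_eq_eq)
qed

lemma coth_minus_1_pos: "0 < u \<Longrightarrow> 0 < coth u - 1"
  by (simp add: coth_minus_1)

lemma coth_measurable [measurable]: "coth \<in> borel_measurable borel"
  unfolding coth_def by measurable

lemma coth_minus_1_sums:
  assumes "0 < u"
  shows "(\<lambda>k. 2 * exp (- (2 * real (Suc k) * u))) sums (coth u - 1)"
proof -
  let ?r = "exp (- (2 * u))"
  have "(\<lambda>k. 2 * ?r * ?r ^ k) sums (2 * ?r * (1 / (1 - ?r)))"
    using assms by (intro sums_mult geometric_sums) simp
  moreover have "2 * ?r * ?r ^ k = 2 * exp (- (2 * real (Suc k) * u))" for k
    by (simp add: algebra_simps flip: exp_of_nat_mult exp_add)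
  ultimately show ?thesis
    using assms by (simp add: coth_minus_1)
qed

text \<open>The kernel at \<open>u = exp (- t)\<close>, multiplied by \<open>u powr \<sigma>\<close>. With \<open>t\<close> the difference of the logarithmic
coordinates of \<open>x\<close> and \<open>y\<close>, \<open>u\<close> is the quotient of the norms.\<close>

definition coth_log_kernel :: "real \<Rightarrow> real \<Rightarrow> real" where
  "coth_log_kernel \<sigma> t = (coth (exp (- t)) - 1) * exp (- (\<sigma> * t))"

lemma coth_log_kernel_pos: "0 < coth_log_kernel \<sigma> t"
  using coth_minus_1_pos[of "exp (- t)"] by (simp add: coth_log_kernel_def)

lemma coth_log_kernel_measurable [measurable]: "coth_log_kernel \<sigma> \<in> borel_measurable borel"
  unfolding coth_log_kernel_def by measurable

lemma summable_zeta_real: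
  assumes "1 < s"
  shows "summable (\<lambda>k. real (Suc k) powr (- s))"
  using assms summable_real_powr_iff[of "- s"] by (subst summable_Suc_iff) simp

lemma zeta_real_pos: "1 < s \<Longrightarrow> 0 < zeta_real s"
  unfolding zeta_real_def by (intro suminf_pos summable_zeta_real) auto

text \<open>The integral of \<open>coth_log_kernel \<sigma>\<close> over the line.\<close>

definition coth_mass :: "real \<Rightarrow> real" where
  "coth_mass \<sigma> = Gamma \<sigma> / 2 powr (\<sigma> - 1) * zeta_real \<sigma>"

lemma coth_mass_pos: "1 < \<sigma> \<Longrightarrow> 0 < coth_mass \<sigma>"
  unfolding coth_mass_def by (intro mult_pos_pos divide_pos_pos Gamma_real_pos zeta_real_pos) auto

text \<open>The kernel is a geometric series of exponentials in \<open>u\<close>; the terms integrate to values of the Gamma function,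
and their sum is the zeta function.\<close>

lemma nn_integral_coth_log_kernel:
  assumes \<sigma>: "1 < \<sigma>"
  shows "(\<integral>\<^sup>+t. ennreal (coth_log_kernel \<sigma> t) \<partial>lborel) = ennreal (coth_mass \<sigma>)"
proof -
  let ?c = "Gamma \<sigma> / 2 powr (\<sigma> - 1)"
  have c: "0 < ?c" using \<sigma> by (simp add: Gamma_real_pos)
  have "ennreal (coth_log_kernel \<sigma> t)
      = (\<Sum>k. ennreal (2 * (exp (- (\<sigma> * t)) * exp (- (2 * real (Suc k) * exp (- (1 * t)))))))" for t
  proof -
    have "(\<lambda>k. 2 * exp (- (2 * real (Suc k) * exp (- t))) * exp (- (\<sigma> * t))) sums coth_log_kernel \<sigma> t"
      unfolding coth_log_kernel_def by (intro sums_mult2 coth_minus_1_sums) simp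
    then have "(\<lambda>k. 2 * (exp (- (\<sigma> * t)) * exp (- (2 * real (Suc k) * exp (- (1 * t)))))) sums coth_log_kernel \<sigma> t"
      by (simp add: mult_ac)
    then show ?thesis
      by (intro suminf_ennreal_eq[symmetric]) auto
  qed
  then have "(\<integral>\<^sup>+t. ennreal (coth_log_kernel \<sigma> t) \<partial>lborel)
      = (\<Sum>k. \<integral>\<^sup>+t. ennreal (2 * (exp (- (\<sigma> * t)) * exp (- (2 * real (Suc k) * exp (- (1 * t)))))) \<partial>lborel)"
    by (simp only:) (rule nn_integral_suminf, measurable)
  also have "\<dots> = (\<Sum>k. ennreal (?c * real (Suc k) powr (- \<sigma>)))"
  proof (intro suminf_cong)
    fix k
    have "(\<integral>\<^sup>+t. ennreal (2 * (exp (- (\<sigma> * t)) * exp (- (2 * real (Suc k) * exp (- (1 * t)))))) \<partial>lborel)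
        = ennreal 2 * (\<integral>\<^sup>+t. ennreal (exp (- (\<sigma> * t)) * exp (- (2 * real (Suc k) * exp (- (1 * t))))) \<partial>lborel)"
      by (subst nn_integral_cmult[symmetric]) (auto simp: ennreal_mult')
    also have "(\<integral>\<^sup>+t. ennreal (exp (- (\<sigma> * t)) * exp (- (2 * real (Suc k) * exp (- (1 * t))))) \<partial>lborel)
        = ennreal (Gamma (\<sigma> / 1) * (2 * real (Suc k)) powr (- (\<sigma> / 1)) / 1)"
      using \<sigma> by (intro nn_integral_Gamma_log) auto
    also have "ennreal 2 * \<dots> = ennreal (2 * (Gamma \<sigma> * (2 * real (Suc k)) powr (- \<sigma>)))"
      by (subst ennreal_mult') auto
    also have "2 * (Gamma \<sigma> * (2 * real (Suc k)) powr (- \<sigma>)) = ?c * real (Suc k) powr (- \<sigma>)"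
    proof -
      have "2 * (Gamma \<sigma> * (2 * real (Suc k)) powr (- \<sigma>))
          = Gamma \<sigma> * (2 * 2 powr (- \<sigma>)) * real (Suc k) powr (- \<sigma>)"
        unfolding powr_mult by (simp only: mult_ac)
      also have "2 * 2 powr (- \<sigma>) = 1 / 2 powr (\<sigma> - 1)"
        by (simp add: powr_diff powr_minus field_simps)
      finally show ?thesis by simp
    qed
    finally show "(\<integral>\<^sup>+t. ennreal (2 * (exp (- (\<sigma> * t)) * exp (- (2 * real (Suc k) * exp (- (1 * t)))))) \<partial>lborel)
        = ennreal (?c * real (Suc k) powr (- \<sigma>))" .
  qed
  also have "\<dots> = ennreal (?c * zeta_real \<sigma>)"
  proof (rule suminf_ennreal_eq)
    show "(\<lambda>k. ?c * real (Suc k) powr (- \<sigma>)) sums (?c * zeta_real \<sigma>)"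
      unfolding zeta_real_def by (intro sums_mult summable_sums summable_zeta_real \<sigma>)
    show "0 \<le> ?c * real (Suc k) powr (- \<sigma>)" for k
      using c by (intro mult_nonneg_nonneg) auto
  qed
  finally show ?thesis
    by (simp only: coth_mass_def)
qed

text \<open>The weight \<open>exp (c t)\<close> turns \<open>\<sigma>\<close> into \<open>\<sigma> - c\<close>, so the mass stays finite as long as \<open>\<sigma> - c > 1\<close>. Here
\<open>\<sigma> > 1\<close> leaves room for some \<open>c > 0\<close>.\<close>

lemma nn_integral_coth_log_kernel_tilted:
  assumes "1 < \<sigma>"
  obtains d where "0 < d" "(\<integral>\<^sup>+t. ennreal (coth_log_kernel \<sigma> t * exp (d * \<bar>t\<bar>)) \<partial>lborel) < \<infinity>"
proof
  define d where "d = (\<sigma> - 1) / 2"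
  show "0 < d" using assms by (simp add: d_def)
  have shift: "coth_log_kernel \<sigma> t * exp (c * t) = coth_log_kernel (\<sigma> - c) t" for c t
    by (simp add: coth_log_kernel_def mult.assoc algebra_simps flip: exp_add)
  have "(\<integral>\<^sup>+t. ennreal (coth_log_kernel \<sigma> t * exp (d * \<bar>t\<bar>)) \<partial>lborel)
      \<le> (\<integral>\<^sup>+t. ennreal (coth_log_kernel (\<sigma> - d) t) + ennreal (coth_log_kernel (\<sigma> - - d) t) \<partial>lborel)"
  proof (intro nn_integral_mono)
    fix t :: real
    have "coth_log_kernel \<sigma> t * exp (d * \<bar>t\<bar>) \<le> coth_log_kernel (\<sigma> - d) t + coth_log_kernel (\<sigma> - - d) t"
      using coth_log_kernel_pos[of "\<sigma> - d" t] coth_log_kernel_pos[of "\<sigma> - - d" t]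
      unfolding shift[symmetric] by (cases "0 \<le> t") auto
    then have "ennreal (coth_log_kernel \<sigma> t * exp (d * \<bar>t\<bar>))
        \<le> ennreal (coth_log_kernel (\<sigma> - d) t + coth_log_kernel (\<sigma> - - d) t)"
      by (rule ennreal_leI)
    also have "\<dots> = ennreal (coth_log_kernel (\<sigma> - d) t) + ennreal (coth_log_kernel (\<sigma> - - d) t)"
      by (intro ennreal_plus less_imp_le coth_log_kernel_pos)
    finally show "ennreal (coth_log_kernel \<sigma> t * exp (d * \<bar>t\<bar>))
        \<le> ennreal (coth_log_kernel (\<sigma> - d) t) + ennreal (coth_log_kernel (\<sigma> - - d) t)" .
  qed
  also have "\<dots> < \<infinity>"
    using assms nn_integral_coth_log_kernel[of "\<sigma> - d"] nn_integral_coth_log_kernel[of "\<sigma> - - d"]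
    by (subst nn_integral_add) (auto simp: d_def field_simps)
  finally show "(\<integral>\<^sup>+t. ennreal (coth_log_kernel \<sigma> t * exp (d * \<bar>t\<bar>)) \<partial>lborel) < \<infinity>" .
qed

section \<open>Logarithmic coordinates on the orthant\<close>

text \<open>The measure \<open>dx / norm_exp \<alpha> x ^ d\<close> on the positive orthant of dimension \<open>d\<close>, which is invariant under
dilations.\<close>

definition log_measure :: "real \<Rightarrow> (real ^ 'd) measure" where
  "log_measure \<alpha> = density orthant_measure (\<lambda>x. ennreal (norm_exp \<alpha> x powr (- real CARD('d))))"

text \<open>The logarithmic coordinate of the radius, with the sign used in the polar formula.\<close>

definition log_coord :: "real \<Rightarrow> real ^ 'd \<Rightarrow> real" where
  "log_coord \<alpha> x = - ln (norm_exp \<alpha> x)"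

lemma norm_exp_measurable_orthant [measurable]: "norm_exp \<alpha> \<in> borel_measurable orthant_measure"
  by (intro measurable_restrict_space1 measurable_completion) simp

lemma space_log_measure [simp]: "space (log_measure \<alpha>) = pos_orthant"
  and sets_log_measure [measurable_cong]: "sets (log_measure \<alpha> :: (real ^ 'd) measure) = sets orthant_measure"
  by (simp_all add: log_measure_def)

lemma nn_integral_log_measure:
  fixes h :: "real ^ 'd \<Rightarrow> ennreal"
  assumes [measurable]: "h \<in> borel_measurable orthant_measure"
  shows "(\<integral>\<^sup>+x. h x \<partial>log_measure \<alpha>)
    = (\<integral>\<^sup>+x. ennreal (norm_exp \<alpha> x powr (- real CARD('d))) * h x \<partial>orthant_measure)"
  unfolding log_measure_def by (rule nn_integral_density) measurable

lemma log_coord_measurable [measurable]: "log_coord \<alpha> \<in> borel_measurable orthant_measure"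
  unfolding log_coord_def by measurable

lemma sigma_finite_lebesgue: "sigma_finite_measure (lebesgue :: 'a::euclidean_space measure)"
proof
  obtain A :: "'a set set" where A: "countable A" "A \<subseteq> sets lborel" "\<Union>A = space lborel"
    "\<forall>a\<in>A. emeasure lborel a \<noteq> \<infinity>"
    using lborel.sigma_finite_countable by blast
  have "emeasure lebesgue a = emeasure lborel a" if "a \<in> A" for a
    using A that by (intro emeasure_completion[THEN trans]) (auto simp: main_part_sets)
  then show "\<exists>A :: 'a set set. countable A \<and> A \<subseteq> sets lebesgue \<and> \<Union>A = space lebesgue \<and>
      (\<forall>a\<in>A. emeasure lebesgue a \<noteq> \<infinity>)"
    using A by (intro exI[of _ A]) auto
qed

lemma sigma_finite_log_measure: "sigma_finite_measure (log_measure \<alpha> :: (real ^ 'd) measure)"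
proof -
  interpret sigma_finite_measure "orthant_measure :: (real ^ 'd) measure"
    by (intro sigma_finite_measure_restrict_space sigma_finite_lebesgue) simp
  show ?thesis
    unfolding log_measure_def by (subst sigma_finite_iff_density_finite) auto
qed

lemma distr_log_measure:
  assumes \<alpha>: "0 < \<alpha>"
  shows "distr (log_measure \<alpha> :: (real ^ 'd) measure) borel (log_coord \<alpha>)
    = density lborel (\<lambda>_. ennreal (sphere_const CARD('d) \<alpha>))"
proof (rule measure_eqI)
  let ?d = "real CARD('d)" and ?S = "sphere_const CARD('d) \<alpha>"
  fix A assume "A \<in> sets (distr (log_measure \<alpha> :: (real ^ 'd) measure) borel (log_coord \<alpha>))"
  then have [measurable]: "A \<in> sets borel" by simp
  have "emeasure (distr (log_measure \<alpha> :: (real ^ 'd) measure) borel (log_coord \<alpha>)) A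
      = (\<integral>\<^sup>+s. indicator A s \<partial>distr (log_measure \<alpha> :: (real ^ 'd) measure) borel (log_coord \<alpha>))"
    by (rule nn_integral_indicator[symmetric]) simp
  also have "\<dots> = (\<integral>\<^sup>+x. indicator A (log_coord \<alpha> x) \<partial>(log_measure \<alpha> :: (real ^ 'd) measure))"
    by (rule nn_integral_distr) measurable
  also have "\<dots> = (\<integral>\<^sup>+x. ennreal (norm_exp \<alpha> x powr (- ?d)) * indicator A (log_coord \<alpha> x)
      \<partial>(orthant_measure :: (real ^ 'd) measure))"
    by (rule nn_integral_log_measure) measurable
  also have "\<dots> = (\<integral>\<^sup>+x. ennreal (exp (?d * (- ln (norm_exp \<alpha> x)))) * indicator A (- ln (norm_exp \<alpha> x))
      \<partial>(orthant_measure :: (real ^ 'd) measure))"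
    by (intro nn_integral_cong) (auto simp: powr_def log_coord_def dest: norm_exp_pos[of _ \<alpha>])
  also have "\<dots> = (\<integral>\<^sup>+s. ennreal (?d * (?S / ?d) * exp (- (?d * s))) * (ennreal (exp (?d * s)) * indicator A s) \<partial>lborel)"
    by (rule nn_integral_minus_ln)
       (use \<alpha> emeasure_norm_exp_less[OF \<alpha>, where 'd = 'd] sphere_const_pos[OF \<alpha>, of "CARD('d)"] in
         \<open>auto intro: norm_exp_pos\<close>)
  also have "\<dots> = (\<integral>\<^sup>+s. ennreal ?S * indicator A s \<partial>lborel)"
  proof (intro nn_integral_cong)
    fix s
    have "ennreal (?d * (?S / ?d) * exp (- (?d * s))) * ennreal (exp (?d * s)) = ennreal ?S"
      using sphere_const_pos[OF \<alpha>, of "CARD('d)"]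
      by (simp add: mult.assoc flip: ennreal_mult exp_add)
    then show "ennreal (?d * (?S / ?d) * exp (- (?d * s))) * (ennreal (exp (?d * s)) * indicator A s)
        = ennreal ?S * indicator A s"
      by (simp only: mult.assoc[symmetric])
  qed
  also have "\<dots> = emeasure (density lborel (\<lambda>_. ennreal ?S)) A"
    by (simp add: emeasure_density)
  finally show "emeasure (distr (log_measure \<alpha> :: (real ^ 'd) measure) borel (log_coord \<alpha>)) A
      = emeasure (density lborel (\<lambda>_. ennreal ?S)) A" .
qed simp

lemma log_kernel_orthant:
  assumes "0 < \<alpha>" "0 < \<beta>" "1 < \<sigma>"
  shows "log_kernel (log_measure \<alpha> :: (real ^ 'm) measure) (log_measure \<beta> :: (real ^ 'n) measure)
    (log_coord \<alpha>) (log_coord \<beta>) (coth_log_kernel \<sigma>)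
    (sphere_const CARD('m) \<alpha>) (sphere_const CARD('n) \<beta>) (coth_mass \<sigma>)"
  using assms
  by (intro log_kernel.intro log_kernel_axioms.intro sigma_finite_log_measure)
     (auto simp: distr_log_measure nn_integral_coth_log_kernel coth_log_kernel_pos sphere_const_pos coth_mass_pos)

section \<open>Back to the original weights\<close>

text \<open>Multiplication by a power of the norm. With the exponents \<open>m - \<sigma>\<close> for \<open>f\<close> and \<open>n + \<sigma>\<close> for \<open>g\<close> it turns
the weighted integrals of \<open>f\<close> and \<open>g\<close> into unweighted ones with respect to \<open>log_measure\<close>.\<close>

definition rescale :: "real \<Rightarrow> real \<Rightarrow> (real ^ 'd \<Rightarrow> real) \<Rightarrow> real ^ 'd \<Rightarrow> real" where
  "rescale \<alpha> c h x = norm_exp \<alpha> x powr c * h x"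

lemma rescale_measurable [measurable]:
  assumes [measurable]: "h \<in> borel_measurable orthant_measure"
  shows "rescale \<alpha> c h \<in> borel_measurable orthant_measure"
  unfolding rescale_def by measurable

lemma rescale_nonneg: "0 \<le> h x \<Longrightarrow> 0 \<le> rescale \<alpha> c h x"
  by (simp add: rescale_def)

lemma rescale_inverse: "x \<in> pos_orthant \<Longrightarrow> rescale \<alpha> c (rescale \<alpha> (- c) h) x = h x"
  using norm_exp_pos[of x \<alpha>] by (simp add: rescale_def mult.assoc[symmetric] flip: powr_add)

lemma weighted_norm_rescale:
  fixes h :: "real ^ 'd \<Rightarrow> real"
  assumes [measurable]: "h \<in> borel_measurable orthant_measure"
  shows "weighted_norm r (\<lambda>x. norm_exp \<alpha> x powr (r * c - real CARD('d))) h
    = (\<integral>\<^sup>+x. ennreal (rescale \<alpha> c h x) epowr r \<partial>log_measure \<alpha>) epowr (1 / r)"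
proof -
  have "(\<integral>\<^sup>+x. ennreal (rescale \<alpha> c h x) epowr r \<partial>log_measure \<alpha>)
      = (\<integral>\<^sup>+x. ennreal (norm_exp \<alpha> x powr (- real CARD('d))) * ennreal (rescale \<alpha> c h x) epowr r
          \<partial>orthant_measure)"
    by (rule nn_integral_log_measure) measurable
  also have "\<dots> = (\<integral>\<^sup>+x. ennreal (norm_exp \<alpha> x powr (r * c - real CARD('d))) * ennreal (h x) epowr r
          \<partial>orthant_measure)"
  proof (intro nn_integral_cong)
    fix x :: "real ^ 'd" assume "x \<in> space orthant_measure"
    then have pos: "0 < norm_exp \<alpha> x" by (intro norm_exp_pos) simp
    have "ennreal (rescale \<alpha> c h x) epowr r = ennreal (norm_exp \<alpha> x powr (c * r)) * ennreal (h x) epowr r"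
      using pos by (simp add: rescale_def ennreal_mult' epowr_mult_ennreal powr_powr)
    moreover have "norm_exp \<alpha> x powr (- real CARD('d)) * norm_exp \<alpha> x powr (c * r)
        = norm_exp \<alpha> x powr (r * c - real CARD('d))"
      by (simp add: mult.commute flip: powr_add)
    ultimately show "ennreal (norm_exp \<alpha> x powr (- real CARD('d))) * ennreal (rescale \<alpha> c h x) epowr r
        = ennreal (norm_exp \<alpha> x powr (r * c - real CARD('d))) * ennreal (h x) epowr r"
      by (simp add: mult.assoc[symmetric] flip: ennreal_mult)
  qed
  finally show ?thesis
    by (simp add: weighted_norm_def)
qed

lemma epowr_inverse_bounds_iff:
  assumes "r \<noteq> 0"
  shows "0 < I epowr (1 / r) \<and> I epowr (1 / r) < \<infinity> \<longleftrightarrow> 0 < I \<and> I < \<infinity>"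
  using assms epowr_eq_0_iff[of I "1 / r"] epowr_eq_top_iff[of I "1 / r"]
  by (auto simp: zero_less_iff_neq_zero less_top)

lemma admissible_rescale_iff:
  fixes h :: "real ^ 'd \<Rightarrow> real"
  assumes "r \<noteq> 0"
  shows "h \<in> admissible r (\<lambda>x. norm_exp \<alpha> x powr (r * c - real CARD('d))) \<longleftrightarrow>
    h \<in> borel_measurable orthant_measure \<and> (\<forall>x\<in>pos_orthant. 0 \<le> h x) \<and>
    0 < (\<integral>\<^sup>+x. ennreal (rescale \<alpha> c h x) epowr r \<partial>log_measure \<alpha>) \<and>
    (\<integral>\<^sup>+x. ennreal (rescale \<alpha> c h x) epowr r \<partial>log_measure \<alpha>) < \<infinity>"
  by (cases "h \<in> borel_measurable orthant_measure")
     (simp_all add: admissible_def weighted_norm_rescale epowr_inverse_bounds_iff[OF assms, simplified])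

text \<open>The operator of the locale \<open>log_kernel\<close> for the hyperbolic cotangent kernel on the orthants.\<close>

abbreviation kernel_transform ::
  "real \<Rightarrow> real \<Rightarrow> real \<Rightarrow> (real ^ 'm \<Rightarrow> real) \<Rightarrow> real ^ 'n \<Rightarrow> ennreal" where
  "kernel_transform \<alpha> \<beta> \<sigma> \<equiv>
     log_kernel.T (log_measure \<alpha>) (log_coord \<alpha>) (log_coord \<beta>) (coth_log_kernel \<sigma>)"

lemma coth_log_kernel_eq:
  assumes "x \<in> pos_orthant" "y \<in> pos_orthant"
  shows "coth_log_kernel \<sigma> (log_coord \<alpha> x - log_coord \<beta> y)
    = kernel \<alpha> \<beta> x y * (norm_exp \<alpha> x powr \<sigma> * norm_exp \<beta> y powr (- \<sigma>))"
proof -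
  note pos = norm_exp_pos[OF assms(1), of \<alpha>] norm_exp_pos[OF assms(2), of \<beta>]
  have "exp (- (log_coord \<alpha> x - log_coord \<beta> y)) = norm_exp \<alpha> x / norm_exp \<beta> y"
    using pos by (simp add: log_coord_def exp_diff)
  moreover have "exp (- (\<sigma> * (log_coord \<alpha> x - log_coord \<beta> y))) = norm_exp \<alpha> x powr \<sigma> * norm_exp \<beta> y powr (- \<sigma>)"
    using pos by (simp add: log_coord_def powr_def algebra_simps flip: exp_add)
  ultimately show ?thesis
    by (simp add: coth_log_kernel_def kernel_def)
qed

context
  fixes \<alpha> \<beta> \<sigma> :: real
  assumes params: "0 < \<alpha>" "0 < \<beta>" "1 < \<sigma>"
begin

lemma inner_integral_eq:
  fixes f :: "real ^ 'm \<Rightarrow> real" and y :: "real ^ 'n"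
  assumes f[measurable]: "f \<in> borel_measurable orthant_measure"
    and y: "y \<in> pos_orthant"
  shows "(\<integral>\<^sup>+x. ennreal (kernel \<alpha> \<beta> x y * f x) \<partial>orthant_measure)
    = ennreal (norm_exp \<beta> y powr \<sigma>) * kernel_transform \<alpha> \<beta> \<sigma> (rescale \<alpha> (real CARD('m) - \<sigma>) f) y"
proof -
  interpret log_kernel "log_measure \<alpha> :: (real ^ 'm) measure" "log_measure \<beta> :: (real ^ 'n) measure"
    "log_coord \<alpha>" "log_coord \<beta>" "coth_log_kernel \<sigma>" "sphere_const CARD('m) \<alpha>" "sphere_const CARD('n) \<beta>"
    "coth_mass \<sigma>"
    by (rule log_kernel_orthant[OF params])
  let ?m = "real CARD('m)" and ?F = "rescale \<alpha> (real CARD('m) - \<sigma>) f" and ?s = "norm_exp \<beta> y"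
  let ?k = "\<lambda>x. coth_log_kernel \<sigma> (log_coord \<alpha> x - log_coord \<beta> y)"
  have pos_y: "0 < ?s" using y by (rule norm_exp_pos)
  define t where "t = log_coord \<beta> y"
  have "T ?F y = (\<integral>\<^sup>+x. ennreal (norm_exp \<alpha> x powr (- ?m)) * (ennreal (?k x) * ennreal (?F x)) \<partial>orthant_measure)"
    unfolding T_def t_def[symmetric] by (rule nn_integral_log_measure) measurable
  then have "ennreal (?s powr \<sigma>) * T ?F y = (\<integral>\<^sup>+x. ennreal (?s powr \<sigma>) *
      (ennreal (norm_exp \<alpha> x powr (- ?m)) * (ennreal (?k x) * ennreal (?F x))) \<partial>orthant_measure)"
    unfolding t_def[symmetric] by (simp add: nn_integral_cmult)
  also have "\<dots> = (\<integral>\<^sup>+x. ennreal (kernel \<alpha> \<beta> x y * f x) \<partial>orthant_measure)"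
  proof (intro nn_integral_cong)
    fix x :: "real ^ 'm" assume "x \<in> space orthant_measure"
    then have x: "x \<in> pos_orthant" by simp
    have pos_x: "0 < norm_exp \<alpha> x" using x by (rule norm_exp_pos)
    let ?r = "norm_exp \<alpha> x"
    have k0: "0 \<le> ?k x" using coth_log_kernel_pos[of \<sigma>] by (simp add: less_imp_le)
    have "?s powr \<sigma> * (?r powr (- ?m) * (?k x * ?F x))
        = (?s powr \<sigma> * ?s powr (- \<sigma>)) * (?r powr (- ?m) * (?r powr \<sigma> * ?r powr (?m - \<sigma>)))
          * (kernel \<alpha> \<beta> x y * f x)"
      unfolding coth_log_kernel_eq[OF x y] rescale_def by (simp only: mult_ac)
    also have "?s powr \<sigma> * ?s powr (- \<sigma>) = 1"
      using pos_y by (simp flip: powr_add)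
    also have "?r powr (- ?m) * (?r powr \<sigma> * ?r powr (?m - \<sigma>)) = 1"
      using pos_x by (simp flip: powr_add)
    finally have "?s powr \<sigma> * (?r powr (- ?m) * (?k x * ?F x)) = kernel \<alpha> \<beta> x y * f x"
      by simp
    then show "ennreal (?s powr \<sigma>) * (ennreal (?r powr (- ?m)) * (ennreal (?k x) * ennreal (?F x)))
        = ennreal (kernel \<alpha> \<beta> x y * f x)"
      using k0 by (simp flip: ennreal_mult')
  qed
  finally show ?thesis by (rule sym)
qed

lemma kernel_transform_measurable:
  fixes F :: "real ^ 'm \<Rightarrow> real"
  assumes "F \<in> borel_measurable orthant_measure"
  shows "(kernel_transform \<alpha> \<beta> \<sigma> F :: real ^ 'n \<Rightarrow> ennreal) \<in> borel_measurable orthant_measure"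
proof -
  interpret log_kernel "log_measure \<alpha> :: (real ^ 'm) measure" "log_measure \<beta> :: (real ^ 'n) measure"
    "log_coord \<alpha>" "log_coord \<beta>" "coth_log_kernel \<sigma>" "sphere_const CARD('m) \<alpha>" "sphere_const CARD('n) \<beta>"
    "coth_mass \<sigma>"
    by (rule log_kernel_orthant[OF params])
  show ?thesis
    using T_measurable[of F] assms by (simp cong: measurable_cong_sets add: sets_log_measure)
qed

lemma lhs_B_eq:
  fixes f :: "real ^ 'm \<Rightarrow> real"
  assumes f[measurable]: "f \<in> borel_measurable orthant_measure"
  shows "lhs_B TYPE('n) \<alpha> \<beta> p \<sigma> f
    = (\<integral>\<^sup>+(y :: real ^ 'n). kernel_transform \<alpha> \<beta> \<sigma> (rescale \<alpha> (real CARD('m) - \<sigma>) f) y epowr p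
        \<partial>log_measure \<beta>) epowr (1 / p)"
proof -
  let ?T = "kernel_transform \<alpha> \<beta> \<sigma> (rescale \<alpha> (real CARD('m) - \<sigma>) f) :: real ^ 'n \<Rightarrow> ennreal"
  have [measurable]: "?T \<in> borel_measurable orthant_measure"
    by (intro kernel_transform_measurable) measurable
  have "(\<integral>\<^sup>+y. ?T y epowr p \<partial>log_measure \<beta>)
      = (\<integral>\<^sup>+y. ennreal (norm_exp \<beta> y powr (- real CARD('n))) * ?T y epowr p \<partial>orthant_measure)"
    by (rule nn_integral_log_measure) measurable
  also have "\<dots> = (\<integral>\<^sup>+(y :: real ^ 'n). ennreal (norm_exp \<beta> y powr (- p * \<sigma> - real CARD('n))) *
        ((\<integral>\<^sup>+x. ennreal (kernel \<alpha> \<beta> x y * f x) \<partial>orthant_measure) epowr p) \<partial>orthant_measure)"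
  proof (intro nn_integral_cong)
    fix y :: "real ^ 'n" assume "y \<in> space orthant_measure"
    then have y: "y \<in> pos_orthant" by simp
    then have pos: "0 < norm_exp \<beta> y" by (rule norm_exp_pos)
    have "norm_exp \<beta> y powr (- p * \<sigma> - real CARD('n)) * norm_exp \<beta> y powr (\<sigma> * p)
        = norm_exp \<beta> y powr (- real CARD('n))"
      by (simp add: algebra_simps flip: powr_add)
    then show "ennreal (norm_exp \<beta> y powr (- real CARD('n))) * ?T y epowr p
        = ennreal (norm_exp \<beta> y powr (- p * \<sigma> - real CARD('n))) *
          ((\<integral>\<^sup>+x. ennreal (kernel \<alpha> \<beta> x y * f x) \<partial>orthant_measure) epowr p)"
      using pos unfolding inner_integral_eq[OF f y]
      by (simp add: epowr_mult_ennreal powr_powr mult.assoc[symmetric] flip: ennreal_mult)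
  qed
  finally show ?thesis
    by (simp add: lhs_B_def)
qed

lemma lhs_A_eq:
  fixes f :: "real ^ 'm \<Rightarrow> real" and g :: "real ^ 'n \<Rightarrow> real"
  assumes f[measurable]: "f \<in> borel_measurable orthant_measure"
    and g[measurable]: "g \<in> borel_measurable orthant_measure"
    and nonneg: "\<forall>y\<in>pos_orthant. 0 \<le> g y"
  shows "lhs_A \<alpha> \<beta> f g
    = (\<integral>\<^sup>+y. kernel_transform \<alpha> \<beta> \<sigma> (rescale \<alpha> (real CARD('m) - \<sigma>) f) y *
        ennreal (rescale \<beta> (real CARD('n) + \<sigma>) g y) \<partial>log_measure \<beta>)"
proof -
  let ?T = "kernel_transform \<alpha> \<beta> \<sigma> (rescale \<alpha> (real CARD('m) - \<sigma>) f) :: real ^ 'n \<Rightarrow> ennreal"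
  let ?n = "real CARD('n)" and ?G = "rescale \<beta> (real CARD('n) + \<sigma>) g"
  have [measurable]: "?T \<in> borel_measurable orthant_measure"
    by (intro kernel_transform_measurable) measurable
  have "(\<integral>\<^sup>+y. ?T y * ennreal (?G y) \<partial>log_measure \<beta>)
      = (\<integral>\<^sup>+y. ennreal (norm_exp \<beta> y powr (- ?n)) * (?T y * ennreal (?G y)) \<partial>orthant_measure)"
    by (rule nn_integral_log_measure) measurable
  also have "\<dots> = (\<integral>\<^sup>+y. (\<integral>\<^sup>+x. ennreal (kernel \<alpha> \<beta> x y * f x * g y) \<partial>orthant_measure) \<partial>orthant_measure)"
  proof (intro nn_integral_cong)
    fix y :: "real ^ 'n" assume "y \<in> space orthant_measure"
    then have y: "y \<in> pos_orthant" by simp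
    have gy: "0 \<le> g y" using nonneg y by blast
    have [measurable]: "(\<lambda>x :: real ^ 'm. kernel \<alpha> \<beta> x y) \<in> borel_measurable orthant_measure"
      unfolding kernel_def by measurable
    have "(\<integral>\<^sup>+x. ennreal (kernel \<alpha> \<beta> x y * f x * g y) \<partial>orthant_measure)
        = (\<integral>\<^sup>+x. ennreal (kernel \<alpha> \<beta> x y * f x) * ennreal (g y) \<partial>orthant_measure)"
      using gy by (intro nn_integral_cong) (simp add: ennreal_mult'')
    also have "\<dots> = ennreal (norm_exp \<beta> y powr \<sigma>) * ?T y * ennreal (g y)"
      by (subst nn_integral_multc) (measurable, simp add: inner_integral_eq[OF f y])
    also have "\<dots> = ennreal (norm_exp \<beta> y powr \<sigma> * g y) * ?T y"
      using gy by (simp add: ennreal_mult mult_ac)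
    also have "norm_exp \<beta> y powr \<sigma> * g y = norm_exp \<beta> y powr (- ?n) * ?G y"
      using norm_exp_pos[OF y, of \<beta>] by (simp add: rescale_def mult.assoc[symmetric] flip: powr_add)
    also have "ennreal \<dots> * ?T y = ennreal (norm_exp \<beta> y powr (- ?n)) * (?T y * ennreal (?G y))"
      by (simp add: ennreal_mult' mult_ac)
    finally show "ennreal (norm_exp \<beta> y powr (- ?n)) * (?T y * ennreal (?G y))
        = (\<integral>\<^sup>+x. ennreal (kernel \<alpha> \<beta> x y * f x * g y) \<partial>orthant_measure)" by (rule sym)
  qed
  finally show ?thesis
    by (simp add: lhs_A_def)
qed

end

section \<open>The inequalities, their equivalence and the best constant\<close>

theorem theorem1:
  fixes \<alpha> \<beta> \<sigma> p q K :: real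
    and A B A_rev B_rev :: "real \<Rightarrow> bool"
  assumes "0 < \<alpha>" and "0 < \<beta>" and "1 < \<sigma>"
    and "p \<noteq> 0" and "p \<noteq> 1" and "1 / p + 1 / q = 1"
    and K: "K = best_const CARD('m::finite) CARD('n::finite) \<alpha> \<beta> p q \<sigma>"
    and A: "A = ineq_A TYPE('m) TYPE('n) (<) \<alpha> \<beta> p q \<sigma>"
    and B: "B = ineq_B TYPE('m) TYPE('n) (<) \<alpha> \<beta> p \<sigma>"
    and A_rev: "A_rev = ineq_A TYPE('m) TYPE('n) (>) \<alpha> \<beta> p q \<sigma>"
    and B_rev: "B_rev = ineq_B TYPE('m) TYPE('n) (>) \<alpha> \<beta> p \<sigma>"
  shows "(1 < p \<longrightarrow>
            A K \<and> B K \<and> (A K \<longleftrightarrow> B K) \<and>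
            (\<forall>C<K. \<not> A C) \<and> (\<forall>C<K. \<not> B C)) \<and>
         (0 < p \<and> p < 1 \<or> p < 0 \<longrightarrow>
            A_rev K \<and> B_rev K \<and> (A_rev K \<longleftrightarrow> B_rev K) \<and>
            (\<forall>C>K. \<not> A_rev C) \<and> (\<forall>C>K. \<not> B_rev C))"
proof -
  note params = \<open>0 < \<alpha>\<close> \<open>0 < \<beta>\<close> \<open>1 < \<sigma>\<close>
  have q0: "q \<noteq> 0"
    using \<open>p \<noteq> 1\<close> \<open>1 / p + 1 / q = 1\<close> by auto
  note pq = \<open>p \<noteq> 0\<close> q0 \<open>1 / p + 1 / q = 1\<close>
  interpret log_kernel "log_measure \<alpha> :: (real ^ 'm) measure" "log_measure \<beta> :: (real ^ 'n) measure"
    "log_coord \<alpha>" "log_coord \<beta>" "coth_log_kernel \<sigma>" "sphere_const CARD('m) \<alpha>" "sphere_const CARD('n) \<beta>"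
    "coth_mass \<sigma>"
    by (rule log_kernel_orthant[OF params])
  have K_eq: "K = best p q"
    unfolding best_def unfolding K best_const_def sphere_const_def coth_mass_def by (simp only: mult.assoc)
  let ?c = "real CARD('m) - \<sigma>" and ?d = "real CARD('n) + \<sigma>"
  let ?adm_f = "admissible p (Phi \<alpha> \<sigma> p :: real ^ 'm \<Rightarrow> real)"
  let ?adm_g = "admissible q (Psi \<beta> \<sigma> q :: real ^ 'n \<Rightarrow> real)"
  let ?nf = "weighted_norm p (Phi \<alpha> \<sigma> p :: real ^ 'm \<Rightarrow> real)"
  let ?ng = "weighted_norm q (Psi \<beta> \<sigma> q :: real ^ 'n \<Rightarrow> real)"
  let ?F = "rescale \<alpha> ?c :: (real ^ 'm \<Rightarrow> real) \<Rightarrow> _" and ?G = "rescale \<beta> ?d :: (real ^ 'n \<Rightarrow> real) \<Rightarrow> _"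
  have Phi_eq: "(Phi \<alpha> \<sigma> p :: real ^ 'm \<Rightarrow> real) = (\<lambda>x. norm_exp \<alpha> x powr (p * ?c - real CARD('m)))"
    by (simp add: Phi_def fun_eq_iff)
  have Psi_eq: "(Psi \<beta> \<sigma> q :: real ^ 'n \<Rightarrow> real) = (\<lambda>y. norm_exp \<beta> y powr (q * ?d - real CARD('n)))"
    by (simp add: Psi_def fun_eq_iff)
  have adm_f: "f \<in> ?adm_f \<longleftrightarrow> f \<in> borel_measurable orthant_measure \<and> (\<forall>x\<in>pos_orthant. 0 \<le> f x) \<and>
      0 < (\<integral>\<^sup>+x. ennreal (?F f x) epowr p \<partial>log_measure \<alpha>) \<and>
      (\<integral>\<^sup>+x. ennreal (?F f x) epowr p \<partial>log_measure \<alpha>) < \<infinity>" for f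
    unfolding Phi_eq using pq by (intro admissible_rescale_iff)
  have adm_g: "g \<in> ?adm_g \<longleftrightarrow> g \<in> borel_measurable orthant_measure \<and> (\<forall>y\<in>pos_orthant. 0 \<le> g y) \<and>
      0 < (\<integral>\<^sup>+y. ennreal (?G g y) epowr q \<partial>log_measure \<beta>) \<and>
      (\<integral>\<^sup>+y. ennreal (?G g y) epowr q \<partial>log_measure \<beta>) < \<infinity>" for g
    unfolding Psi_eq using pq by (intro admissible_rescale_iff)
  have nf: "?nf f = (\<integral>\<^sup>+x. ennreal (?F f x) epowr p \<partial>log_measure \<alpha>) epowr (1 / p)"
    if "f \<in> borel_measurable orthant_measure" for f
    unfolding Phi_eq using that by (rule weighted_norm_rescale)
  have ng: "?ng g = (\<integral>\<^sup>+y. ennreal (?G g y) epowr q \<partial>log_measure \<beta>) epowr (1 / q)"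
    if "g \<in> borel_measurable orthant_measure" for g
    unfolding Psi_eq using that by (rule weighted_norm_rescale)
  have meas_F: "?F f \<in> borel_measurable (log_measure \<alpha>)" if "f \<in> borel_measurable orthant_measure" for f
    using that by (simp add: rescale_measurable sets_log_measure cong: measurable_cong_sets)
  have meas_G: "?G g \<in> borel_measurable (log_measure \<beta>)" if "g \<in> borel_measurable orthant_measure" for g
    using that by (simp add: rescale_measurable sets_log_measure cong: measurable_cong_sets)

  \<comment> \<open>The test functions, transported back to the original weights.\<close>
  define f0 where "f0 e = rescale \<alpha> (- ?c) (test_F p e)" for e
  define g0 where "g0 e = rescale \<beta> (- ?d) (test_G q e)" for e
  have F_f0: "?F (f0 e) x = test_F p e x" if "x \<in> pos_orthant" for e x
    unfolding f0_def using that by (rule rescale_inverse)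
  have G_g0: "?G (g0 e) y = test_G q e y" if "y \<in> pos_orthant" for e y
    unfolding g0_def using that by (rule rescale_inverse)
  have int_F: "(\<integral>\<^sup>+x. ennreal (?F (f0 e) x) epowr p \<partial>log_measure \<alpha>)
      = (\<integral>\<^sup>+x. ennreal (test_F p e x) epowr p \<partial>log_measure \<alpha>)" for e
    by (intro nn_integral_cong) (simp add: F_f0)
  have int_G: "(\<integral>\<^sup>+y. ennreal (?G (g0 e) y) epowr q \<partial>log_measure \<beta>)
      = (\<integral>\<^sup>+y. ennreal (test_G q e y) epowr q \<partial>log_measure \<beta>)" for e
    by (intro nn_integral_cong) (simp add: G_g0)
  have f0_meas: "f0 e \<in> borel_measurable orthant_measure" and g0_meas: "g0 e \<in> borel_measurable orthant_measure" for e
    using test_F_measurable[of p e] test_G_measurable[of q e]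
    by (simp_all add: f0_def g0_def rescale_measurable sets_log_measure cong: measurable_cong_sets)
  have f0_nonneg: "0 \<le> f0 e x" and g0_nonneg: "0 \<le> g0 e y" for e x y
    by (simp_all add: f0_def g0_def rescale_def test_F_def test_G_def)
  have test_adm: "f0 e \<in> ?adm_f" "g0 e \<in> ?adm_g" if e: "0 < e" for e
  proof -
    obtain z where "0 < z" "Z e = ennreal z"
      by (rule norms_test[OF pq e])
    then show "f0 e \<in> ?adm_f" "g0 e \<in> ?adm_g"
      using S_pos pq f0_meas g0_meas f0_nonneg g0_nonneg
      by (auto simp: adm_f adm_g int_F int_G norm_test_F norm_test_G ennreal_zero_less_mult_iff
          ennreal_mult_less_top)
  qed
  have lhs_test: "lhs_A \<alpha> \<beta> (f0 e) (g0 e)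
      = (\<integral>\<^sup>+y. T (test_F p e) y * ennreal (test_G q e y) \<partial>log_measure \<beta>)" for e
  proof -
    have "T (?F (f0 e)) y = T (test_F p e) y" for y
      unfolding T_def by (intro nn_integral_cong) (simp add: F_f0)
    then show ?thesis
      unfolding lhs_A_eq[OF params f0_meas g0_meas ballI[OF g0_nonneg]]
      by (intro nn_integral_cong) (simp add: G_g0)
  qed
  have rhs_test: "?nf (f0 e) * ?ng (g0 e) = (\<integral>\<^sup>+x. ennreal (test_F p e x) epowr p \<partial>log_measure \<alpha>) epowr (1 / p) *
      (\<integral>\<^sup>+y. ennreal (test_G q e y) epowr q \<partial>log_measure \<beta>) epowr (1 / q)" for e
    by (simp add: nf ng f0_meas g0_meas int_F int_G)

  have "A K \<and> B K \<and> (\<forall>C<K. \<not> A C) \<and> (\<forall>C<K. \<not> B C)" if p: "1 < p"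
  proof -
    have BK: "B K"
      unfolding B ineq_B_def K_eq
    proof
      fix f assume f: "f \<in> ?adm_f"
      note f' = f[unfolded adm_f]
      show "lhs_B TYPE('n) \<alpha> \<beta> p \<sigma> f < ennreal (best p q) * ?nf f"
        unfolding lhs_B_eq[OF params f'[THEN conjunct1]] nf[OF f'[THEN conjunct1]]
        by (rule norm_T_less) (use f' p pq in \<open>simp_all add: meas_F rescale_nonneg\<close>)
    qed
    \<comment> \<open>The second inequality implies the first with the same constant; optimality carries over
      in the opposite direction.\<close>
    have BA: "A C" if "B C" for C
      unfolding A ineq_A_def
    proof (intro ballI)
      fix f g assume f: "f \<in> ?adm_f" and g: "g \<in> ?adm_g"
      have mf: "f \<in> borel_measurable orthant_measure" and mg: "g \<in> borel_measurable orthant_measure"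
        using f g by (auto simp: adm_f adm_g)
      have g_nonneg: "\<forall>y\<in>pos_orthant. 0 \<le> g y"
        using g by (auto simp: adm_g)
      have "lhs_A \<alpha> \<beta> f g \<le> lhs_B TYPE('n) \<alpha> \<beta> p \<sigma> f * ?ng g"
        unfolding lhs_A_eq[OF params mf mg g_nonneg] lhs_B_eq[OF params mf] ng[OF mg]
        by (rule form_le_norms) (use mf mg p pq in \<open>simp_all add: meas_F meas_G\<close>)
      also have "\<dots> < ennreal C * ?nf f * ?ng g"
      proof (rule ennreal_mult_strict_right_mono)
        show "lhs_B TYPE('n) \<alpha> \<beta> p \<sigma> f < ennreal C * ?nf f"
          using that f unfolding B ineq_B_def by blast
      qed (use g in \<open>simp_all add: admissible_def\<close>)
      finally show "lhs_A \<alpha> \<beta> f g < ennreal C * ?nf f * ?ng g" .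
    qed
    have not_A: "\<not> A C" if "C < K" for C
    proof
      assume AC: "A C"
      \<comment> \<open>A negative C is the constant 0 after the coercion to extended nonnegative reals.\<close>
      have "best p q \<le> max 0 C"
      proof (rule best_le_if_form_le[OF pq])
        fix e :: real assume e: "0 < e"
        have "lhs_A \<alpha> \<beta> (f0 e) (g0 e) < ennreal C * ?nf (f0 e) * ?ng (g0 e)"
          using AC test_adm[OF e] unfolding A ineq_A_def by blast
        then have "lhs_A \<alpha> \<beta> (f0 e) (g0 e) \<le> ennreal C * (?nf (f0 e) * ?ng (g0 e))"
          unfolding mult.assoc by (rule less_imp_le)
        also have "ennreal C = ennreal (max 0 C)"
          by (simp add: max_def ennreal_neg)
        finally show "(\<integral>\<^sup>+y. T (test_F p e) y * ennreal (test_G q e y) \<partial>log_measure \<beta>)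
          \<le> ennreal (max 0 C) * ((\<integral>\<^sup>+x. ennreal (test_F p e x) epowr p \<partial>log_measure \<alpha>) epowr (1 / p) *
            (\<integral>\<^sup>+y. ennreal (test_G q e y) epowr q \<partial>log_measure \<beta>) epowr (1 / q))"
          unfolding lhs_test rhs_test .
      qed simp
      then show False
        using that best_pos[of p q] by (simp add: K_eq)
    qed
    show ?thesis
      using BK BA not_A by blast
  qed
  moreover have "A_rev K \<and> B_rev K \<and> (\<forall>C>K. \<not> A_rev C) \<and> (\<forall>C>K. \<not> B_rev C)" if p: "p < 1"
  proof -
    have BK: "B_rev K"
      unfolding B_rev ineq_B_def K_eq
    proof
      fix f assume f: "f \<in> ?adm_f"
      note f' = f[unfolded adm_f]
      show "ennreal (best p q) * ?nf f < lhs_B TYPE('n) \<alpha> \<beta> p \<sigma> f"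
        unfolding lhs_B_eq[OF params f'[THEN conjunct1]] nf[OF f'[THEN conjunct1]]
        by (rule norm_T_greater) (use f' p pq in \<open>simp_all add: meas_F rescale_nonneg\<close>)
    qed
    \<comment> \<open>As in the direct case, now by the reverse Hoelder inequality.\<close>
    have BA: "A_rev C" if "B_rev C" for C
      unfolding A_rev ineq_A_def
    proof (intro ballI)
      fix f g assume f: "f \<in> ?adm_f" and g: "g \<in> ?adm_g"
      have mf: "f \<in> borel_measurable orthant_measure" and mg: "g \<in> borel_measurable orthant_measure"
        using f g by (auto simp: adm_f adm_g)
      have g_nonneg: "\<forall>y\<in>pos_orthant. 0 \<le> g y"
        using g by (auto simp: adm_g)
      have "ennreal C * ?nf f * ?ng g < lhs_B TYPE('n) \<alpha> \<beta> p \<sigma> f * ?ng g"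
      proof (rule ennreal_mult_strict_right_mono)
        show "ennreal C * ?nf f < lhs_B TYPE('n) \<alpha> \<beta> p \<sigma> f"
          using that f unfolding B_rev ineq_B_def by blast
      qed (use g in \<open>simp_all add: admissible_def\<close>)
      also have "\<dots> \<le> lhs_A \<alpha> \<beta> f g"
        unfolding lhs_A_eq[OF params mf mg g_nonneg] lhs_B_eq[OF params mf] ng[OF mg]
        by (rule form_ge_norms) (use mf mg p pq in \<open>simp_all add: meas_F meas_G\<close>)
      finally show "ennreal C * ?nf f * ?ng g < lhs_A \<alpha> \<beta> f g" .
    qed
    have not_A: "\<not> A_rev C" if "K < C" for C
    proof
      assume AC: "A_rev C"
      obtain d where d: "0 < d" "tilted d < \<infinity>"
        using nn_integral_coth_log_kernel_tilted[OF \<open>1 < \<sigma>\<close>] unfolding tilted_def by blast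
      have "C \<le> best p q"
      proof (rule best_ge_if_form_ge[OF pq _ d])
        show "0 \<le> C"
          using that best_pos[of p q] by (simp add: K_eq)
        fix e :: real assume e: "0 < e"
        have "ennreal C * ?nf (f0 e) * ?ng (g0 e) < lhs_A \<alpha> \<beta> (f0 e) (g0 e)"
          using AC test_adm[OF e] unfolding A_rev ineq_A_def by blast
        then have "ennreal C * (?nf (f0 e) * ?ng (g0 e)) \<le> lhs_A \<alpha> \<beta> (f0 e) (g0 e)"
          unfolding mult.assoc by (rule less_imp_le)
        then show "ennreal C * ((\<integral>\<^sup>+x. ennreal (test_F p e x) epowr p \<partial>log_measure \<alpha>) epowr (1 / p) *
            (\<integral>\<^sup>+y. ennreal (test_G q e y) epowr q \<partial>log_measure \<beta>) epowr (1 / q))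
          \<le> (\<integral>\<^sup>+y. T (test_F p e) y * ennreal (test_G q e y) \<partial>log_measure \<beta>)"
          unfolding lhs_test rhs_test .
      qed
      then show False
        using that by (simp add: K_eq)
    qed
    show ?thesis
      using BK BA not_A by blast
  qed
  ultimately show ?thesis
    by auto
qed

end
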